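(* Let $m\in\mathbb N$, $s_0\in(0,1]$, and let $V\in L^1_{\mathrm{loc}}(\mathbb R^d)$ be a measurable function such that $V(x)>0$ for a.e. $x\in\mathbb R^d$. Let $\mathcal L_V$ be the associated Schrödinger operator. (a) If $f\in D(\log^{m+1}\mathcal L_V)\cap D(\mathcal L_V^{s_0})$, then $$\mathcal L_V^sf-\sum_{k=0}^m\frac{s^k}{k!}(\log^k\mathcal L_V)f=o(s^m)\quad\text{as } s\to0^+,\ \text{in } L^2(\mathbb R^d).$$ (b) If $f\in D(\log^{m+1}\mathcal L_V)\cap D(\mathcal L_V^{-s_0})$, then $$\mathcal L_V^{-s}f-\sum_{k=0}^m(-1)^k\frac{s^k}{k!}(\log^k\mathcal L_V)f=o(s^m)\quad\text{as } s\to0^+,\ \text{in } L^2(\mathbb R^d).$$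
   Context: Operator: for $V\in L^1_{\mathrm{loc}}(\mathbb R^d)$ with $V>0$ a.e., let $T(f,g)=\int_{\mathbb R^d}\nabla f\cdot\overline{\nabla g}\,dx+\int_{\mathbb R^d}Vf\overline g\,dx$ with form domain $D(T)=\{f\in L^2(\mathbb R^d):\nabla f\in L^2(\mathbb R^d),\ \sqrt Vf\in L^2(\mathbb R^d)\}$ (weak gradient). This is a densely defined closed nonnegative form, and $\mathcal L_V$ (formally $-\Delta+V$) denotes the nonnegative self-adjoint operator on $L^2(\mathbb R^d)$ associated with it: $f\in D(\mathcal L_V)$ with $\mathcal L_Vf=h$ iff $f\in D(T)$, $h\in L^2(\mathbb R^d)$ and $T(f,g)=\langle h,g\rangle$ for all $g\in D(T)$. Since $V>0$ a.e., $0$ is not an eigenvalue of $\mathcal L_V$. Let $E_V$ be the spectral measure of $\mathcal L_V$ and $\mu_{f,g}^V(U)=\langle E_V(U)f,g\rangle$ for Borel sets $U\subset(0,\infty)$. Functional calculus: for a Borel function $\Phi$ on $(0,\infty)$, $\Phi(\mathcal L_V)f=\int_0^\infty\Phi(\lambda)\,dE_V(\lambda)f$ with domain $D(\Phi(\mathcal L_V))=\{f\in L^2(\mathbb R^d):\int_0^\infty|\Phi(\lambda)|^2d\mu^V_{f,f}(\lambda)<\infty\}$. In particular $\mathcal L_V^{s}$ ($s\in\mathbb R\setminus\{0\}$) corresponds to $\Phi(\lambda)=\lambda^s$, and $\log^k\mathcal L_V$ ($k\in\mathbb N$) to $\Phi(\lambda)=(\log\lambda)^k$; $\log^0\mathcal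 L_V$ is the identity. "$F(s)=o(s^m)$ as $s\to0^+$ in $L^2(\mathbb R^d)$" means $\lim_{s\to0^+}s^{-m}\|F(s)\|_{L^2(\mathbb R^d)}=0$. *)

theory Defs
  imports "HOL-Analysis.Analysis"
begin

section \<open>The space \<open>L\<^sup>2(\<real>\<^sup>d)\<close>\<close>

text \<open>Elements of \<open>L\<^sup>2\<close> are represented by functions; two representatives denote the same
  element iff they agree almost everywhere.\<close>

definition L2 :: "(real ^ 'n \<Rightarrow> complex) set" where
  "L2 = {f. f \<in> borel_measurable lebesgue \<and> integrable lebesgue (\<lambda>x. (cmod (f x))\<^sup>2)}"

definition L2_inner :: "(real ^ 'n \<Rightarrow> complex) \<Rightarrow> (real ^ 'n \<Rightarrow> complex) \<Rightarrow> complex" where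
  "L2_inner f g = (LINT x|lebesgue. f x * cnj (g x))"

definition L2_norm :: "(real ^ 'n \<Rightarrow> complex) \<Rightarrow> real" where
  "L2_norm f = sqrt (LINT x|lebesgue. (cmod (f x))\<^sup>2)"

definition ae_eq :: "(real ^ 'n \<Rightarrow> complex) \<Rightarrow> (real ^ 'n \<Rightarrow> complex) \<Rightarrow> bool" where
  "ae_eq f g \<longleftrightarrow> (AE x in lebesgue. f x = g x)"

text \<open>\<open>F(s) = o(s\<^sup>m)\<close> as \<open>s \<rightarrow> 0+\<close> in \<open>L\<^sup>2\<close>. Membership in \<open>L\<^sup>2\<close> is demanded explicitly because
  the Bochner integral of a non-integrable function is \<open>0\<close>.\<close>

definition L2_small_o :: "(real \<Rightarrow> real ^ 'n \<Rightarrow> complex) \<Rightarrow> nat \<Rightarrow> bool" where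
  "L2_small_o F m \<longleftrightarrow>
     (\<forall>\<^sub>F s in at_right 0. F s \<in> L2) \<and>
     ((\<lambda>s. L2_norm (F s) / s ^ m) \<longlongrightarrow> 0) (at_right 0)"


section \<open>Weak gradient\<close>

definition locally_integrable ::
    "(real ^ 'n \<Rightarrow> 'b :: {banach, second_countable_topology}) \<Rightarrow> bool" where
  "locally_integrable f \<longleftrightarrow> (\<forall>K. compact K \<longrightarrow> set_integrable lebesgue K f)"

definition partial :: "'n \<Rightarrow> (real ^ 'n \<Rightarrow> real) \<Rightarrow> real ^ 'n \<Rightarrow> real" where
  "partial i \<phi> x = frechet_derivative \<phi> (at x) (axis i 1)"

primrec Ck :: "nat \<Rightarrow> (real ^ 'n \<Rightarrow> real) \<Rightarrow> bool" where
  "Ck 0 \<phi> \<longleftrightarrow> continuous_on UNIV \<phi>"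
| "Ck (Suc k) \<phi> \<longleftrightarrow> (\<forall>x. \<phi> differentiable (at x)) \<and> (\<forall>i. Ck k (partial i \<phi>))"

definition test_function :: "(real ^ 'n \<Rightarrow> real) \<Rightarrow> bool" where
  "test_function \<phi> \<longleftrightarrow> (\<forall>k. Ck k \<phi>) \<and> compact (closure {x. \<phi> x \<noteq> 0})"

definition has_weak_partial ::
    "'n \<Rightarrow> (real ^ 'n \<Rightarrow> complex) \<Rightarrow> (real ^ 'n \<Rightarrow> complex) \<Rightarrow> bool" where
  "has_weak_partial i f g \<longleftrightarrow>
     locally_integrable f \<and> locally_integrable g \<and>
     (\<forall>\<phi>. test_function \<phi> \<longrightarrow>
        (LINT x|lebesgue. f x * of_real (partial i \<phi> x)) =
        - (LINT x|lebesgue. g x * of_real (\<phi> x)))"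

text \<open>Weak derivatives are unique only up to null sets, so a representative is chosen.\<close>

definition weak_partial :: "'n \<Rightarrow> (real ^ 'n \<Rightarrow> complex) \<Rightarrow> real ^ 'n \<Rightarrow> complex" where
  "weak_partial i f = (SOME g. has_weak_partial i f g)"


section \<open>The Schroedinger form and its operator\<close>

definition form_dom :: "(real ^ 'n \<Rightarrow> real) \<Rightarrow> (real ^ 'n \<Rightarrow> complex) set" where
  "form_dom V = {f \<in> L2.
     (\<forall>i. (\<exists>g. has_weak_partial i f g) \<and> weak_partial i f \<in> L2) \<and>
     (\<lambda>x. of_real (sqrt (V x)) * f x) \<in> L2}"

definition form ::
    "(real ^ 'n \<Rightarrow> real) \<Rightarrow> (real ^ 'n \<Rightarrow> complex) \<Rightarrow> (real ^ 'n \<Rightarrow> complex) \<Rightarrow> complex" where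
  "form V f g =
     (LINT x|lebesgue. (\<Sum>i\<in>UNIV. weak_partial i f x * cnj (weak_partial i g x))) +
     (LINT x|lebesgue. of_real (V x) * f x * cnj (g x))"

text \<open>The graph of \<open>\<L>\<^sub>V\<close>: \<open>schroedinger_op V f h\<close> means that \<open>f \<in> D(\<L>\<^sub>V)\<close> and \<open>\<L>\<^sub>V f = h\<close>.\<close>

definition schroedinger_op ::
    "(real ^ 'n \<Rightarrow> real) \<Rightarrow> (real ^ 'n \<Rightarrow> complex) \<Rightarrow> (real ^ 'n \<Rightarrow> complex) \<Rightarrow> bool" where
  "schroedinger_op V f h \<longleftrightarrow>
     f \<in> form_dom V \<and> h \<in> L2 \<and> (\<forall>g \<in> form_dom V. form V f g = L2_inner h g)"


section \<open>Projection-valued measures and spectral integrals\<close>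

definition orthogonal_projection ::
    "((real ^ 'n \<Rightarrow> complex) \<Rightarrow> real ^ 'n \<Rightarrow> complex) \<Rightarrow> bool" where
  "orthogonal_projection P \<longleftrightarrow>
     (\<forall>f\<in>L2. P f \<in> L2) \<and>
     (\<forall>f\<in>L2. \<forall>g\<in>L2. ae_eq f g \<longrightarrow> ae_eq (P f) (P g)) \<and>
     (\<forall>f\<in>L2. \<forall>g\<in>L2. ae_eq (P (\<lambda>x. f x + g x)) (\<lambda>x. P f x + P g x)) \<and>
     (\<forall>c. \<forall>f\<in>L2. ae_eq (P (\<lambda>x. c * f x)) (\<lambda>x. c * P f x)) \<and>
     (\<forall>f\<in>L2. ae_eq (P (P f)) (P f)) \<and>
     (\<forall>f\<in>L2. \<forall>g\<in>L2. L2_inner (P f) g = L2_inner f (P g))"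

definition projection_valued_measure ::
    "(real set \<Rightarrow> (real ^ 'n \<Rightarrow> complex) \<Rightarrow> real ^ 'n \<Rightarrow> complex) \<Rightarrow> bool" where
  "projection_valued_measure E \<longleftrightarrow>
     (\<forall>U \<in> sets borel. orthogonal_projection (E U)) \<and>
     (\<forall>f\<in>L2. ae_eq (E {} f) (\<lambda>x. 0)) \<and>
     (\<forall>f\<in>L2. ae_eq (E UNIV f) f) \<and>
     (\<forall>U \<in> sets borel. \<forall>W \<in> sets borel. \<forall>f\<in>L2. ae_eq (E (U \<inter> W) f) (E U (E W f))) \<and>
     (\<forall>U :: nat \<Rightarrow> real set. range U \<subseteq> sets borel \<longrightarrow> disjoint_family U \<longrightarrow>
        (\<forall>f\<in>L2. (\<lambda>N. L2_norm (\<lambda>x. (\<Sum>n<N. E (U n) f x) - E (\<Union>n. U n) f x)) \<longlonglongrightarrow> 0))"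

definition spectral_mu ::
    "(real set \<Rightarrow> (real ^ 'n \<Rightarrow> complex) \<Rightarrow> real ^ 'n \<Rightarrow> complex) \<Rightarrow>
     (real ^ 'n \<Rightarrow> complex) \<Rightarrow> (real ^ 'n \<Rightarrow> complex) \<Rightarrow> real set \<Rightarrow> complex" where
  "spectral_mu E f g U = L2_inner (E U f) g"

text \<open>\<open>spectral_mu E f f\<close> takes values in the nonnegative reals; here it is as a measure.\<close>

definition spectral_diag ::
    "(real set \<Rightarrow> (real ^ 'n \<Rightarrow> complex) \<Rightarrow> real ^ 'n \<Rightarrow> complex) \<Rightarrow>
     (real ^ 'n \<Rightarrow> complex) \<Rightarrow> real measure" where
  "spectral_diag E f = measure_of UNIV (sets borel) (\<lambda>U. ennreal (Re (spectral_mu E f f U)))"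

definition simple_spectral_integral ::
    "(real set \<Rightarrow> (real ^ 'n \<Rightarrow> complex) \<Rightarrow> real ^ 'n \<Rightarrow> complex) \<Rightarrow> (real \<Rightarrow> complex) \<Rightarrow>
     (real ^ 'n \<Rightarrow> complex) \<Rightarrow> real ^ 'n \<Rightarrow> complex" where
  "simple_spectral_integral E s f = (\<lambda>x. \<Sum>c\<in>range s. c * E (s -` {c}) f x)"

text \<open>\<open>\<integral> \<Phi>(\<lambda>) dE(\<lambda>) f = h\<close> over \<open>\<real>\<close>: the limit in \<open>L\<^sup>2\<close> of the integrals of simple functions
  that converge to \<open>\<Phi>\<close> in \<open>L\<^sup>2(\<mu>\<^bsub>f,f\<^esub>)\<close>. On simple functions \<open>s\<close> the map
  \<open>s \<mapsto> \<integral> s dE f\<close> is an isometry into \<open>L\<^sup>2(\<real>\<^sup>d)\<close>, so \<open>h\<close> does not depend on the approximating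
  sequence, and it exists iff \<open>\<Phi> \<in> L\<^sup>2(\<mu>\<^bsub>f,f\<^esub>)\<close>.\<close>

definition has_spectral_integral ::
    "(real set \<Rightarrow> (real ^ 'n \<Rightarrow> complex) \<Rightarrow> real ^ 'n \<Rightarrow> complex) \<Rightarrow> (real \<Rightarrow> complex) \<Rightarrow>
     (real ^ 'n \<Rightarrow> complex) \<Rightarrow> (real ^ 'n \<Rightarrow> complex) \<Rightarrow> bool" where
  "has_spectral_integral E \<Phi> f h \<longleftrightarrow>
     \<Phi> \<in> borel_measurable borel \<and> f \<in> L2 \<and> h \<in> L2 \<and>
     (\<exists>s :: nat \<Rightarrow> real \<Rightarrow> complex.
        (\<forall>n. simple_function borel (s n)) \<and>
        (\<lambda>n. \<integral>\<^sup>+t. ennreal ((cmod (s n t - \<Phi> t))\<^sup>2) \<partial>spectral_diag E f) \<longlonglongrightarrow> 0 \<and>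
        (\<lambda>n. L2_norm (\<lambda>x. simple_spectral_integral E (s n) f x - h x)) \<longlonglongrightarrow> 0)"

text \<open>\<open>E\<close> is the spectral measure of \<open>\<L>\<^sub>V\<close>: \<open>\<L>\<^sub>V = \<integral> \<lambda> dE(\<lambda>)\<close>, including equality of domains.
  By the spectral theorem such an \<open>E\<close> exists and is unique (up to a.e. equality).\<close>

definition spectral_measure_of ::
    "(real ^ 'n \<Rightarrow> real) \<Rightarrow>
     (real set \<Rightarrow> (real ^ 'n \<Rightarrow> complex) \<Rightarrow> real ^ 'n \<Rightarrow> complex) \<Rightarrow> bool" where
  "spectral_measure_of V E \<longleftrightarrow>
     projection_valued_measure E \<and>
     (\<forall>f h. schroedinger_op V f h \<longleftrightarrow> has_spectral_integral E of_real f h)"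


section \<open>Functional calculus on \<open>(0, \<infinity>)\<close>\<close>

definition calc_dom ::
    "(real set \<Rightarrow> (real ^ 'n \<Rightarrow> complex) \<Rightarrow> real ^ 'n \<Rightarrow> complex) \<Rightarrow> (real \<Rightarrow> complex) \<Rightarrow>
     (real ^ 'n \<Rightarrow> complex) set" where
  "calc_dom E \<Phi> =
     {f \<in> L2. (\<integral>\<^sup>+t\<in>{0<..}. ennreal ((cmod (\<Phi> t))\<^sup>2) \<partial>spectral_diag E f) < \<infinity>}"

text \<open>For \<open>f\<close> outside the domain the value is unspecified.\<close>

definition calc ::
    "(real set \<Rightarrow> (real ^ 'n \<Rightarrow> complex) \<Rightarrow> real ^ 'n \<Rightarrow> complex) \<Rightarrow> (real \<Rightarrow> complex) \<Rightarrow>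
     (real ^ 'n \<Rightarrow> complex) \<Rightarrow> real ^ 'n \<Rightarrow> complex" where
  "calc E \<Phi> f =
     (SOME h. has_spectral_integral E (\<lambda>t. indicator {0<..} t * \<Phi> t) f h)"

definition pow_dom ::
    "(real set \<Rightarrow> (real ^ 'n \<Rightarrow> complex) \<Rightarrow> real ^ 'n \<Rightarrow> complex) \<Rightarrow> real \<Rightarrow>
     (real ^ 'n \<Rightarrow> complex) set" where
  "pow_dom E s = calc_dom E (\<lambda>t. of_real (t powr s))"

definition pow_op ::
    "(real set \<Rightarrow> (real ^ 'n \<Rightarrow> complex) \<Rightarrow> real ^ 'n \<Rightarrow> complex) \<Rightarrow> real \<Rightarrow>
     (real ^ 'n \<Rightarrow> complex) \<Rightarrow> real ^ 'n \<Rightarrow> complex" where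
  "pow_op E s = calc E (\<lambda>t. of_real (t powr s))"

definition log_power_dom ::
    "(real set \<Rightarrow> (real ^ 'n \<Rightarrow> complex) \<Rightarrow> real ^ 'n \<Rightarrow> complex) \<Rightarrow> nat \<Rightarrow>
     (real ^ 'n \<Rightarrow> complex) set" where
  "log_power_dom E k = (if k = 0 then L2 else calc_dom E (\<lambda>t. of_real (ln t ^ k)))"

definition log_power ::
    "(real set \<Rightarrow> (real ^ 'n \<Rightarrow> complex) \<Rightarrow> real ^ 'n \<Rightarrow> complex) \<Rightarrow> nat \<Rightarrow>
     (real ^ 'n \<Rightarrow> complex) \<Rightarrow> real ^ 'n \<Rightarrow> complex" where
  "log_power E k f = (if k = 0 then f else calc E (\<lambda>t. of_real (ln t ^ k)) f)"

end

theory Submission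
  imports Defs
begin

text \<open>
  Why the theorem holds. Under the spectral theorem \<open>\<Phi>(\<L>\<^sub>V) f\<close> becomes the multiplication of the constant
  function \<open>1\<close> by \<open>\<Phi>\<close> in \<open>L\<^sup>2(\<mu>)\<close>, where \<open>\<mu> = \<mu>\<^bsub>f,f\<^esub>\<close>, and this correspondence is isometric. The squared
  norm of the remainder is therefore the \<open>\<mu>\<close>-integral of the square of the scalar remainder
  \<open>e\<^bsup>sy\<^esup> - \<Sum>\<^bsub>k\<le>m\<^esub> (sy)\<^sup>k / k!\<close> with \<open>y = log \<lambda>\<close> for positive powers and \<open>y = - log \<lambda>\<close> for negative ones.
  Both cases are one statement about \<open>y = \<sigma> log \<lambda>\<close> with \<open>\<sigma> = \<plusminus>1\<close>.

  For \<open>y \<le> 0\<close> the scalar remainder is at most \<open>s\<^bsup>m+1\<^esup> \<bar>y\<bar>\<^bsup>m+1\<^esup>\<close>, and for \<open>y > 0\<close> the additional factor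
  \<open>e\<^bsup>sy\<^esup>\<close> and the power of \<open>y\<close> are both absorbed by \<open>e\<^bsup>s0 y\<^esup>\<close> as soon as \<open>s \<le> s0/2\<close>. Hence
  it is at most \<open>C s\<^bsup>m+1\<^esup> (\<bar>y\<bar>\<^bsup>m+1\<^esup> + e\<^bsup>s0 y\<^esup>)\<close> (\<open>exp_scaled_Taylor_remainder_le\<close>). The two functions in
  the bracket are square integrable for \<open>\<mu>\<close> by the two domain hypotheses on \<open>f\<close>, so the remainder in
  \<open>L\<^sup>2(\<real>\<^sup>d)\<close> is even \<open>O(s\<^bsup>m+1\<^esup>)\<close> (\<open>log_expansion_of_powers\<close>).

  Two ingredients make this rigorous. First, spectral integrals have to exist and to be isometric:
  \<open>has_spectral_integral_exists\<close>, which rests on the completeness of \<open>L\<^sup>2\<close>, and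
  \<open>spectral_integral_inner\<close>. Secondly, the operators are integrals over \<open>(0,\<infinity>)\<close>, whereas the term with
  \<open>k = 0\<close> is \<open>f\<close> itself; these fit together because \<open>\<mu>\<close> does not charge \<open>(-\<infinity>,0]\<close>
  (\<open>spectral_diag_positive\<close>). This is where the operator enters: on a vector \<open>g\<close> in the spectral subspace
  of \<open>[-n,0]\<close> the form satisfies \<open>T(g,g) = \<integral> \<lambda> d\<mu>\<^bsub>g,g\<^esub> \<le> 0\<close>, while \<open>T(g,g) \<ge> \<integral> V \<bar>g\<bar>\<^sup>2\<close>, and \<open>V > 0\<close>
  almost everywhere forces \<open>g = 0\<close>.
\<close>

section \<open>Square-integrable functions on a measure space\<close>

text \<open>The measure is a parameter because the theory is used twice, for Lebesgue measure on \<open>\<real>\<^sup>d\<close> and for the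
  spectral measures \<open>\<mu>\<^bsub>f,f\<^esub>\<close> on the line.\<close>

definition square_integrable :: "'a measure \<Rightarrow> ('a \<Rightarrow> complex) \<Rightarrow> bool" where
  "square_integrable M f \<longleftrightarrow> f \<in> borel_measurable M \<and> integrable M (\<lambda>x. (cmod (f x))\<^sup>2)"

definition sq_norm :: "'a measure \<Rightarrow> ('a \<Rightarrow> complex) \<Rightarrow> real" where
  "sq_norm M f = (LINT x|M. (cmod (f x))\<^sup>2)"

lemma square_integrable_measurable [measurable_dest]:
  "square_integrable M f \<Longrightarrow> f \<in> borel_measurable M"
  by (simp add: square_integrable_def)

lemma square_integrable_integrable:
  "square_integrable M f \<Longrightarrow> integrable M (\<lambda>x. (cmod (f x))\<^sup>2)"
  by (simp add: square_integrable_def)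

lemma borel_measurable_cnj [measurable (raw)]:
  "f \<in> borel_measurable M \<Longrightarrow> (\<lambda>x. cnj (f x)) \<in> borel_measurable M"
  by (rule borel_measurable_continuous_on[OF continuous_on_cnj[OF continuous_on_id]])

lemma sq_norm_ennreal:
  assumes "square_integrable M f"
  shows "(\<integral>\<^sup>+t. ennreal ((cmod (f t))\<^sup>2) \<partial>M) = ennreal (sq_norm M f)"
  using assms unfolding sq_norm_def
  by (subst nn_integral_eq_integral) (auto simp: square_integrable_def)

lemma square_integrable_iff_nn_integral:
  "square_integrable M f \<longleftrightarrow>
    f \<in> borel_measurable M \<and> (\<integral>\<^sup>+t. ennreal ((cmod (f t))\<^sup>2) \<partial>M) < \<infinity>"
  unfolding square_integrable_def by (auto simp: integrable_iff_bounded)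

text \<open>This inequality, integrated, replaces the triangle inequality of the \<open>L\<^sup>2\<close> norm below, where constants do
  not matter.\<close>

lemma norm_add_sq_le: "(cmod (a + b))\<^sup>2 \<le> 2 * (cmod a)\<^sup>2 + 2 * (cmod b)\<^sup>2"
proof -
  have "(cmod (a + b))\<^sup>2 \<le> (cmod a + cmod b)\<^sup>2"
    by (intro power_mono norm_triangle_ineq) auto
  also have "\<dots> \<le> 2 * (cmod a)\<^sup>2 + 2 * (cmod b)\<^sup>2"
    using sum_squares_bound[of "cmod a" "cmod b"] by (simp add: power2_sum)
  finally show ?thesis .
qed

lemma square_integrable_add:
  assumes [measurable]: "square_integrable M f" "square_integrable M g"
  shows "square_integrable M (\<lambda>x. f x + g x)"
  unfolding square_integrable_def
proof (intro conjI)
  show "integrable M (\<lambda>x. (cmod (f x + g x))\<^sup>2)"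
    by (rule Bochner_Integration.integrable_bound[of _ "\<lambda>x. 2 * (cmod (f x))\<^sup>2 + 2 * (cmod (g x))\<^sup>2"])
      (use assms[THEN square_integrable_integrable] norm_add_sq_le in auto)
qed measurable

lemma square_integrable_cmult:
  assumes "square_integrable M f" shows "square_integrable M (\<lambda>x. c * f x)"
  using assms by (auto simp: square_integrable_def norm_mult power_mult_distrib)

lemma square_integrable_diff:
  assumes "square_integrable M f" "square_integrable M g"
  shows "square_integrable M (\<lambda>x. f x - g x)"
  using square_integrable_add[OF assms(1) square_integrable_cmult[OF assms(2), of "- 1"]] by simp

lemma square_integrable_zero: "square_integrable M (\<lambda>x. 0)"
  by (simp add: square_integrable_def)

lemma square_integrable_sum:
  assumes "\<And>i. i \<in> I \<Longrightarrow> square_integrable M (f i)"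
  shows "square_integrable M (\<lambda>x. \<Sum>i\<in>I. f i x)"
  using assms
proof (induction I rule: infinite_finite_induct)
  case (insert i I)
  then show ?case using square_integrable_add[of M "f i" "\<lambda>x. \<Sum>i\<in>I. f i x"] by simp
qed (simp_all add: square_integrable_zero)

lemma integrable_inner:
  assumes [measurable]: "square_integrable M f" "square_integrable M g"
  shows "integrable M (\<lambda>x. f x * cnj (g x))"
proof (rule Bochner_Integration.integrable_bound[of _ "\<lambda>x. (cmod (f x))\<^sup>2 + (cmod (g x))\<^sup>2"])
  have "cmod (f x * cnj (g x)) \<le> (cmod (f x))\<^sup>2 + (cmod (g x))\<^sup>2" for x
    using sum_squares_bound[of "cmod (f x)" "cmod (g x)"]
      mult_nonneg_nonneg[OF norm_ge_zero norm_ge_zero, of "f x" "g x"]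
    by (simp add: norm_mult del: mult_nonneg_nonneg)
  then show "AE x in M. norm (f x * cnj (g x)) \<le> norm ((cmod (f x))\<^sup>2 + (cmod (g x))\<^sup>2)" by simp
  show "integrable M (\<lambda>x. (cmod (f x))\<^sup>2 + (cmod (g x))\<^sup>2)"
    using assms[THEN square_integrable_integrable] by simp
qed measurable

lemma sq_norm_nonneg: "0 \<le> sq_norm M f"
  by (simp add: sq_norm_def)

lemma inner_self: "(LINT x|M. f x * cnj (f x)) = of_real (sq_norm M f)"
  by (simp add: sq_norm_def flip: complex_norm_square integral_complex_of_real)

lemma sq_norm_add_le:
  assumes "square_integrable M f" "square_integrable M g"
  shows "sq_norm M (\<lambda>x. f x + g x) \<le> 2 * sq_norm M f + 2 * sq_norm M g"
proof -
  have "sq_norm M (\<lambda>x. f x + g x) \<le> (LINT x|M. 2 * (cmod (f x))\<^sup>2 + 2 * (cmod (g x))\<^sup>2)"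
    unfolding sq_norm_def
    using assms[THEN square_integrable_integrable] square_integrable_add[OF assms]
    by (intro integral_mono norm_add_sq_le) (auto simp: square_integrable_def)
  then show ?thesis
    using assms[THEN square_integrable_integrable] by (simp add: sq_norm_def)
qed

lemma sq_norm_minus_commute: "sq_norm M (\<lambda>x. f x - g x) = sq_norm M (\<lambda>x. g x - f x)"
  by (simp add: sq_norm_def norm_minus_commute)

text \<open>The Cauchy-Schwarz inequality.\<close>

lemma inner_le_sqrt:
  assumes f: "square_integrable M f" and g: "square_integrable M g"
  shows "cmod (LINT x|M. f x * cnj (g x)) \<le> sqrt (sq_norm M f) * sqrt (sq_norm M g)"
proof -
  note [measurable] = f g
  have e: "(\<integral>\<^sup>+x. ennreal (cmod (h x)) ^ 2 \<partial>M) = ennreal (sq_norm M h)" if "square_integrable M h" for h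
    using that unfolding sq_norm_def
    by (subst nn_integral_eq_integral[symmetric]) (auto simp: square_integrable_def ennreal_power)
  have "ennreal (LINT x|M. cmod (f x) * cmod (g x)) = (\<integral>\<^sup>+x. ennreal (cmod (f x)) * ennreal (cmod (g x)) \<partial>M)"
    using integrable_norm[OF integrable_inner[OF f g]]
    by (subst nn_integral_eq_integral[symmetric]) (auto simp: norm_mult ennreal_mult)
  then have "ennreal ((LINT x|M. cmod (f x) * cmod (g x))\<^sup>2) \<le> ennreal (sq_norm M f * sq_norm M g)"
    using Cauchy_Schwarz_nn_integral[of "\<lambda>x. ennreal (cmod (f x))" M "\<lambda>x. ennreal (cmod (g x))"]
    by (simp add: e f g ennreal_mult sq_norm_nonneg flip: ennreal_power)
  then have "(LINT x|M. cmod (f x) * cmod (g x))\<^sup>2 \<le> sq_norm M f * sq_norm M g"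
    by (simp add: sq_norm_nonneg)
  then have "(LINT x|M. cmod (f x) * cmod (g x)) \<le> sqrt (sq_norm M f) * sqrt (sq_norm M g)"
    by (simp add: real_le_rsqrt flip: real_sqrt_mult)
  moreover have "cmod (LINT x|M. f x * cnj (g x)) \<le> (LINT x|M. cmod (f x) * cmod (g x))"
    using integral_norm_bound[of M "\<lambda>x. f x * cnj (g x)"] by (simp add: norm_mult)
  ultimately show ?thesis by linarith
qed

lemma inner_sum:
  assumes f: "\<And>i. i \<in> I \<Longrightarrow> square_integrable M (f i)"
    and g: "\<And>j. j \<in> J \<Longrightarrow> square_integrable M (g j)"
  shows "(LINT x|M. (\<Sum>i\<in>I. a i * f i x) * cnj (\<Sum>j\<in>J. b j * g j x)) =
    (\<Sum>i\<in>I. \<Sum>j\<in>J. a i * cnj (b j) * (LINT x|M. f i x * cnj (g j x)))"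
proof -
  have "(LINT x|M. (\<Sum>i\<in>I. a i * f i x) * cnj (\<Sum>j\<in>J. b j * g j x)) =
      (LINT x|M. (\<Sum>i\<in>I. \<Sum>j\<in>J. (a i * cnj (b j)) * (f i x * cnj (g j x))))"
    by (simp add: sum_product mult_ac)
  also have "\<dots> = (\<Sum>i\<in>I. LINT x|M. (\<Sum>j\<in>J. (a i * cnj (b j)) * (f i x * cnj (g j x))))"
    by (intro Bochner_Integration.integral_sum Bochner_Integration.integrable_sum
        integrable_mult_right integrable_inner f g)
  also have "\<dots> = (\<Sum>i\<in>I. \<Sum>j\<in>J. (LINT x|M. (a i * cnj (b j)) * (f i x * cnj (g j x))))"
    by (intro sum.cong refl Bochner_Integration.integral_sum
        integrable_mult_right integrable_inner f g)
  finally show ?thesis by simp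
qed

text \<open>With \<open>u = F n - f\<close> and \<open>v = G n - g\<close> the difference of the inner products is
  \<open>\<langle>u,v\<rangle> + \<langle>u,g\<rangle> + \<langle>f,v\<rangle>\<close>, and each of these tends to zero by the Cauchy-Schwarz inequality.\<close>

lemma inner_tendsto:
  assumes F: "\<And>n. square_integrable M (F n)" "square_integrable M f"
    and G: "\<And>n. square_integrable M (G n)" "square_integrable M g"
    and lF: "(\<lambda>n. sq_norm M (\<lambda>x. F n x - f x)) \<longlonglongrightarrow> 0"
    and lG: "(\<lambda>n. sq_norm M (\<lambda>x. G n x - g x)) \<longlonglongrightarrow> 0"
  shows "(\<lambda>n. LINT x|M. F n x * cnj (G n x)) \<longlonglongrightarrow> (LINT x|M. f x * cnj (g x))"
proof -
  note dF = square_integrable_diff[OF F(1) F(2)] and dG = square_integrable_diff[OF G(1) G(2)]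
  let ?F = "\<lambda>n. sqrt (sq_norm M (\<lambda>x. F n x - f x))" and ?G = "\<lambda>n. sqrt (sq_norm M (\<lambda>x. G n x - g x))"
  have eq: "(LINT x|M. F n x * cnj (G n x)) - (LINT x|M. f x * cnj (g x)) =
      (LINT x|M. (F n x - f x) * cnj (G n x - g x)) + (LINT x|M. (F n x - f x) * cnj (g x))
       + (LINT x|M. f x * cnj (G n x - g x))" for n
    unfolding Bochner_Integration.integral_diff[OF integrable_inner[OF F(1) G(1)] integrable_inner[OF F(2) G(2)], symmetric]
      Bochner_Integration.integral_add[OF integrable_inner[OF dF dG] integrable_inner[OF dF G(2)], symmetric]
      Bochner_Integration.integral_add[OF Bochner_Integration.integrable_add[OF integrable_inner[OF dF dG] integrable_inner[OF dF G(2)]] integrable_inner[OF F(2) dG], symmetric]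
    by (rule Bochner_Integration.integral_cong) (auto simp: algebra_simps)
  have bound: "cmod ((LINT x|M. F n x * cnj (G n x)) - (LINT x|M. f x * cnj (g x))) \<le>
      ?F n * ?G n + ?F n * sqrt (sq_norm M g) + sqrt (sq_norm M f) * ?G n" for n
    unfolding eq
    by (intro norm_triangle_mono inner_le_sqrt dF dG F G)
  have "(\<lambda>n. ?F n * ?G n + ?F n * sqrt (sq_norm M g) + sqrt (sq_norm M f) * ?G n) \<longlonglongrightarrow>
      sqrt 0 * sqrt 0 + sqrt 0 * sqrt (sq_norm M g) + sqrt (sq_norm M f) * sqrt 0"
    by (intro tendsto_intros lF lG)
  then have lim: "(\<lambda>n. ?F n * ?G n + ?F n * sqrt (sq_norm M g) + sqrt (sq_norm M f) * ?G n) \<longlonglongrightarrow> 0"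
    by simp
  have "(\<lambda>n. (LINT x|M. F n x * cnj (G n x)) - (LINT x|M. f x * cnj (g x))) \<longlonglongrightarrow> 0"
    by (rule Lim_null_comparison[OF always_eventually lim]) (use bound in blast)
  then show ?thesis by (rule LIM_zero_cancel)
qed

text \<open>Fatou's lemma, applied to \<open>\<bar>F k - g\<bar>\<^sup>2\<close>: it transfers a uniform bound on the distance to \<open>g\<close> from
  a sequence to its pointwise limit.\<close>

lemma square_integrable_AE_limit:
  assumes sF: "\<And>n. square_integrable M (F n)" and [measurable]: "f \<in> borel_measurable M"
    and lim: "AE x in M. (\<lambda>k. F k x) \<longlonglongrightarrow> f x"
    and b: "\<And>k. k \<ge> N \<Longrightarrow> sq_norm M (\<lambda>x. F k x - g x) \<le> e"
    and g: "square_integrable M g"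
  shows "square_integrable M (\<lambda>x. f x - g x)" "sq_norm M (\<lambda>x. f x - g x) \<le> e"
proof -
  note [measurable] = sF g
  have e: "0 \<le> e" using b[of N] sq_norm_nonneg order_trans by blast
  have "(\<integral>\<^sup>+x. ennreal ((cmod (f x - g x))\<^sup>2) \<partial>M) = (\<integral>\<^sup>+x. liminf (\<lambda>k. ennreal ((cmod (F k x - g x))\<^sup>2)) \<partial>M)"
  proof (intro nn_integral_cong_AE, use lim in eventually_elim)
    case (elim x)
    then have "(\<lambda>k. ennreal ((cmod (F k x - g x))\<^sup>2)) \<longlonglongrightarrow> ennreal ((cmod (f x - g x))\<^sup>2)"
      by (intro tendsto_intros)
    then show ?case by (metis lim_imp_Liminf sequentially_bot)
  qed
  also have "\<dots> \<le> liminf (\<lambda>k. \<integral>\<^sup>+x. ennreal ((cmod (F k x - g x))\<^sup>2) \<partial>M)"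
    by (intro nn_integral_liminf) measurable
  also have "\<dots> \<le> ennreal e"
  proof (intro Liminf_le)
    show "\<forall>\<^sub>F k in sequentially. (\<integral>\<^sup>+x. ennreal ((cmod (F k x - g x))\<^sup>2) \<partial>M) \<le> ennreal e"
      using eventually_ge_at_top[of N]
    proof eventually_elim
      case (elim k)
      then show ?case
        using b[OF elim] square_integrable_diff[OF sF[of k] g]
        by (subst nn_integral_eq_integral) (auto simp: square_integrable_def sq_norm_def e)
    qed
  qed simp
  finally have *: "(\<integral>\<^sup>+x. ennreal ((cmod (f x - g x))\<^sup>2) \<partial>M) \<le> ennreal e" .
  then have "(\<integral>\<^sup>+x. ennreal ((cmod (f x - g x))\<^sup>2) \<partial>M) < \<infinity>"
    by (simp add: order_le_less_trans)
  then show s: "square_integrable M (\<lambda>x. f x - g x)"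
    by (auto simp: square_integrable_def intro!: integrableI_bounded)
  show "sq_norm M (\<lambda>x. f x - g x) \<le> e"
    using * s e by (subst (asm) nn_integral_eq_integral) (auto simp: square_integrable_def sq_norm_def)
qed

text \<open>The weights \<open>4\<^sup>k\<close> still leave \<open>\<Sum> 4\<^sup>k \<bar>F (k+1) - F k\<bar>\<^sup>2\<close> integrable, hence finite almost everywhere.
  At such a point the increments are eventually below \<open>2\<^bsup>-k\<^esup>\<close>, so they are absolutely summable.\<close>

lemma square_integrable_rapid_AE_convergent:
  assumes sF: "\<And>n. square_integrable M (F n)"
    and b: "\<And>k. sq_norm M (\<lambda>x. F (Suc k) x - F k x) \<le> (1/16) ^ k"
  shows "AE x in M. convergent (\<lambda>k. F k x)"
proof -
  note [measurable] = sF
  let ?d = "\<lambda>k x. F (Suc k) x - F k x"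
  have "(\<integral>\<^sup>+x. (\<Sum>k. ennreal (4 ^ k * (cmod (?d k x))\<^sup>2)) \<partial>M) = (\<Sum>k. \<integral>\<^sup>+x. ennreal (4 ^ k * (cmod (?d k x))\<^sup>2) \<partial>M)"
    by (intro nn_integral_suminf) measurable
  also have "\<dots> \<le> (\<Sum>k. ennreal ((1/4) ^ k))"
  proof (intro suminf_le)
    fix k
    have "(\<integral>\<^sup>+x. ennreal (4 ^ k * (cmod (?d k x))\<^sup>2) \<partial>M) = ennreal (4 ^ k * sq_norm M (?d k))"
      using square_integrable_diff[OF sF sF, of "Suc k" k] unfolding sq_norm_def
      by (subst nn_integral_eq_integral) (auto simp: square_integrable_def)
    also have "\<dots> \<le> ennreal (4 ^ k * (1/16) ^ k)"
      by (intro ennreal_leI mult_left_mono b) auto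
    also have "(4 ^ k * (1/16) ^ k :: real) = (1/4) ^ k"
      by (simp flip: power_mult_distrib)
    finally show "(\<integral>\<^sup>+x. ennreal (4 ^ k * (cmod (?d k x))\<^sup>2) \<partial>M) \<le> ennreal ((1/4) ^ k)" .
  qed auto
  also have "\<dots> < \<infinity>"
    by (subst suminf_ennreal2) (auto intro: summable_geometric)
  finally have "AE x in M. (\<Sum>k. ennreal (4 ^ k * (cmod (?d k x))\<^sup>2)) \<noteq> \<infinity>"
    by (intro nn_integral_PInf_AE) auto
  then show ?thesis
  proof eventually_elim
    case (elim x)
    have "summable (\<lambda>k. 4 ^ k * (cmod (?d k x))\<^sup>2)"
      using elim by (intro summable_suminf_not_top) auto
    then have "(\<lambda>k. 4 ^ k * (cmod (?d k x))\<^sup>2) \<longlonglongrightarrow> 0" by (rule summable_LIMSEQ_zero)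
    then have "\<forall>\<^sub>F k in sequentially. 4 ^ k * (cmod (?d k x))\<^sup>2 < 1"
      by (rule order_tendstoD) simp
    then have "\<forall>\<^sub>F k in sequentially. norm (?d k x) \<le> (1/2) ^ k"
    proof eventually_elim
      case (elim k)
      then have "(2 ^ k * cmod (?d k x))\<^sup>2 \<le> 1\<^sup>2"
        by (simp add: power_mult_distrib flip: power_mult) (simp add: power_mult mult.commute[of k])
      then have "2 ^ k * cmod (?d k x) \<le> 1" by (rule power2_le_imp_le) simp
      then show ?case by (simp add: power_divide field_simps)
    qed
    then have "summable (\<lambda>k. ?d k x)"
      by (rule summable_comparison_test_ev) (simp add: summable_geometric)
    then have "convergent (\<lambda>n. (\<Sum>k<n. ?d k x) + F 0 x)"
      by (intro convergent_add) (auto simp: summable_iff_convergent convergent_const)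
    moreover have "(\<lambda>n. (\<Sum>k<n. ?d k x) + F 0 x) = (\<lambda>n. F n x)"
      by (subst sum_lessThan_telescope) simp
    ultimately show ?case by simp
  qed
qed

text \<open>The Riesz-Fischer theorem: a rapidly convergent subsequence has a pointwise limit, and Fatou's lemma
  shows that the whole sequence converges to it in norm.\<close>

lemma square_integrable_complete:
  assumes sF: "\<And>n. square_integrable M (F n)"
    and cauchy: "\<And>e. e > 0 \<Longrightarrow> \<exists>N. \<forall>i\<ge>N. \<forall>j\<ge>N. sq_norm M (\<lambda>x. F i x - F j x) \<le> e"
  obtains f where "square_integrable M f" "(\<lambda>n. sq_norm M (\<lambda>x. F n x - f x)) \<longlonglongrightarrow> 0"
proof -
  note [measurable] = sF
  obtain N where N: "\<And>e i j. e > 0 \<Longrightarrow> i \<ge> N e \<Longrightarrow> j \<ge> N e \<Longrightarrow> sq_norm M (\<lambda>x. F i x - F j x) \<le> e"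
    using cauchy by metis
  \<comment> \<open>Summing up to \<open>k\<close> ensures that both \<open>r k\<close> and \<open>r (k+1)\<close> lie beyond the Cauchy index
    for \<open>16\<^bsup>-k\<^esup>\<close>; the summand \<open>k\<close> makes \<open>r\<close> unbounded.\<close>
  define r where "r k = (\<Sum>i\<le>k. N ((1/16) ^ i)) + k" for k
  have r: "r k \<ge> N ((1/16) ^ k)" "r (Suc k) \<ge> N ((1/16) ^ k)" "r k \<ge> k" for k
  proof -
    have "N ((1/16) ^ k) \<le> (\<Sum>i\<le>k. N ((1/16) ^ i))" by (rule member_le_sum) auto
    then show "r k \<ge> N ((1/16) ^ k)" "r (Suc k) \<ge> N ((1/16) ^ k)" "r k \<ge> k"
      by (simp_all add: r_def trans_le_add1 del: power_Suc)
  qed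
  have "AE x in M. convergent (\<lambda>k. F (r k) x)"
    by (intro square_integrable_rapid_AE_convergent sF N r) auto
  then have lim: "AE x in M. (\<lambda>k. F (r k) x) \<longlonglongrightarrow> lim (\<lambda>k. F (r k) x)"
    by (simp add: convergent_LIMSEQ_iff)
  let ?f = "\<lambda>x. lim (\<lambda>k. F (r k) x)"
  have [measurable]: "?f \<in> borel_measurable M" by measurable
  have *: "square_integrable M (\<lambda>x. ?f x - F n x)" "sq_norm M (\<lambda>x. ?f x - F n x) \<le> e"
    if "e > 0" "n \<ge> N e" for e n
    using square_integrable_AE_limit[of M "\<lambda>k. F (r k)" ?f "N e" "F n" e]
      sF lim N[OF that(1) order_trans[OF _ r(3)] that(2)] by auto
  show thesis
  proof (rule that)
    show "square_integrable M ?f"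
      using square_integrable_add[OF *(1)[of 1 "N 1"] sF[of "N 1"]] by simp
    show "(\<lambda>n. sq_norm M (\<lambda>x. F n x - ?f x)) \<longlonglongrightarrow> 0"
    proof (rule LIMSEQ_I)
      fix e :: real assume "e > 0"
      then show "\<exists>no. \<forall>n\<ge>no. norm (sq_norm M (\<lambda>x. F n x - ?f x) - 0) < e"
        using *(2)[of "e / 2"] sq_norm_nonneg[of M]
        by (intro exI[of _ "N (e/2)"] allI impI)
          (subst sq_norm_minus_commute, use order_le_less_trans field_sum_of_halves in fastforce)
    qed
  qed
qed

section \<open>The space \<open>L\<^sup>2(\<real>\<^sup>d)\<close> and projection-valued measures\<close>

lemma L2_iff: "f \<in> L2 \<longleftrightarrow> square_integrable lebesgue f"
  by (simp add: L2_def square_integrable_def)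

lemma L2_norm_eq: "L2_norm f = sqrt (sq_norm lebesgue f)"
  by (simp add: L2_norm_def sq_norm_def)

lemma L2_norm_tendsto_0_iff:
  "(\<lambda>n. L2_norm (F n)) \<longlonglongrightarrow> 0 \<longleftrightarrow> (\<lambda>n. sq_norm lebesgue (F n)) \<longlonglongrightarrow> 0"
proof
  assume "(\<lambda>n. L2_norm (F n)) \<longlonglongrightarrow> 0"
  then have "(\<lambda>n. (L2_norm (F n))\<^sup>2) \<longlonglongrightarrow> 0\<^sup>2" by (intro tendsto_intros)
  then show "(\<lambda>n. sq_norm lebesgue (F n)) \<longlonglongrightarrow> 0" by (simp add: L2_norm_eq sq_norm_nonneg)
next
  assume "(\<lambda>n. sq_norm lebesgue (F n)) \<longlonglongrightarrow> 0"
  then have "(\<lambda>n. sqrt (sq_norm lebesgue (F n))) \<longlonglongrightarrow> sqrt 0" by (intro tendsto_intros)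
  then show "(\<lambda>n. L2_norm (F n)) \<longlonglongrightarrow> 0" by (simp add: L2_norm_eq)
qed

lemma L2_inner_cong_ae:
  assumes "ae_eq f f'" "f \<in> L2" "f' \<in> L2" "g \<in> L2"
  shows "L2_inner f g = L2_inner f' g"
proof -
  have [measurable]: "f \<in> borel_measurable lebesgue" "f' \<in> borel_measurable lebesgue"
    "g \<in> borel_measurable lebesgue"
    using assms by (auto simp: L2_def)
  show ?thesis
    unfolding L2_inner_def
  proof (rule integral_cong_AE)
    show "AE x in lebesgue. f x * cnj (g x) = f' x * cnj (g x)"
      using assms(1) unfolding ae_eq_def by eventually_elim simp
  qed measurable
qed

lemma sq_norm_eq_0_iff_ae:
  assumes "f \<in> L2" shows "sq_norm lebesgue f = 0 \<longleftrightarrow> ae_eq f (\<lambda>x. 0)"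
  using assms unfolding sq_norm_def ae_eq_def
  by (subst integral_nonneg_eq_0_iff_AE) (auto simp: L2_def)

lemma sets_spectral_diag [measurable_cong]: "sets (spectral_diag E f) = sets borel"
  by (simp add: spectral_diag_def sets.sigma_sets_eq[of borel, simplified])

lemma space_spectral_diag: "space (spectral_diag E f) = UNIV"
  by (simp add: spectral_diag_def)

lemma simple_borel_vimage:
  fixes s :: "real \<Rightarrow> complex"
  assumes "simple_function borel s"
  shows "s -` {c} \<in> sets borel" "finite (range s)"
  using simple_functionD[OF assms] by auto

context
  fixes E :: "real set \<Rightarrow> (real ^ 'n \<Rightarrow> complex) \<Rightarrow> real ^ 'n \<Rightarrow> complex"
  assumes E: "projection_valued_measure E"
begin

lemma pvm_L2: "U \<in> sets borel \<Longrightarrow> f \<in> L2 \<Longrightarrow> E U f \<in> L2"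
  using E by (simp add: projection_valued_measure_def orthogonal_projection_def)

lemma pvm_empty: "f \<in> L2 \<Longrightarrow> ae_eq (E {} f) (\<lambda>x. 0)"
  using E by (simp add: projection_valued_measure_def)

lemma pvm_Int:
  "U \<in> sets borel \<Longrightarrow> W \<in> sets borel \<Longrightarrow> f \<in> L2 \<Longrightarrow> ae_eq (E (U \<inter> W) f) (E U (E W f))"
  using E by (simp add: projection_valued_measure_def)

text \<open>Self-adjointness and multiplicativity of the projections turn every inner product of spectral pieces
  of one vector into a value of its spectral measure. All isometry statements come from this.\<close>

lemma pvm_inner:
  assumes U: "U \<in> sets borel" and W: "W \<in> sets borel" and f: "f \<in> L2" and g: "g \<in> L2"
  shows "L2_inner (E U f) (E W g) = L2_inner (E (U \<inter> W) f) g"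
proof -
  have "L2_inner (E U f) (E W g) = L2_inner (E W (E U f)) g"
    using E W pvm_L2[OF U f] g by (simp add: projection_valued_measure_def orthogonal_projection_def)
  also have "\<dots> = L2_inner (E (W \<inter> U) f) g"
  proof (rule L2_inner_cong_ae)
    have "ae_eq (E (W \<inter> U) f) (E W (E U f))"
      by (rule pvm_Int[OF W U f])
    then show "ae_eq (E W (E U f)) (E (W \<inter> U) f)"
      by (simp add: ae_eq_def eq_commute)
  qed (use U W f g in \<open>auto intro!: pvm_L2\<close>)
  finally show ?thesis by (simp add: Int_commute)
qed

lemma pvm_inner_self:
  assumes U: "U \<in> sets borel" and f: "f \<in> L2"
  shows "L2_inner (E U f) f = of_real (sq_norm lebesgue (E U f))"
  using pvm_inner[OF U U f f] by (simp add: L2_inner_def inner_self)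

text \<open>Strong countable additivity of the projections, tested against \<open>f\<close>.\<close>

lemma pvm_sums:
  fixes A :: "nat \<Rightarrow> real set"
  assumes A: "range A \<subseteq> sets borel" "disjoint_family A" and f: "f \<in> L2"
  shows "(\<lambda>n. sq_norm lebesgue (E (A n) f)) sums sq_norm lebesgue (E (\<Union>n. A n) f)"
proof -
  have An: "A n \<in> sets borel" for n using A(1) by auto
  have UA: "(\<Union>n. A n) \<in> sets borel" using An by auto
  let ?S = "\<lambda>N x. \<Sum>n<N. E (A n) f x"
  have sq: "square_integrable lebesgue (E (A n) f)" "square_integrable lebesgue (E (\<Union>n. A n) f)" for n
    using pvm_L2[OF An f] pvm_L2[OF UA f] by (auto simp: L2_iff)
  have sf: "square_integrable lebesgue f" using f by (simp add: L2_iff)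
  have "(\<lambda>N. LINT x|lebesgue. ?S N x * cnj (f x)) \<longlonglongrightarrow> (LINT x|lebesgue. E (\<Union>n. A n) f x * cnj (f x))"
  proof (rule inner_tendsto)
    show "(\<lambda>N. sq_norm lebesgue (\<lambda>x. ?S N x - E (\<Union>n. A n) f x)) \<longlonglongrightarrow> 0"
      using E A f unfolding L2_norm_tendsto_0_iff[symmetric] projection_valued_measure_def by blast
    show "(\<lambda>N. sq_norm lebesgue (\<lambda>x. f x - f x)) \<longlonglongrightarrow> 0" by (simp add: sq_norm_def)
  qed (intro square_integrable_sum sq sf)+
  also have "(\<lambda>N. LINT x|lebesgue. ?S N x * cnj (f x)) = (\<lambda>N. of_real (\<Sum>n<N. sq_norm lebesgue (E (A n) f)))"
    using pvm_inner_self[OF An f] integrable_inner[OF sq(1) sf]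
    by (simp add: sum_distrib_right L2_inner_def)
  also have "(LINT x|lebesgue. E (\<Union>n. A n) f x * cnj (f x)) = of_real (sq_norm lebesgue (E (\<Union>n. A n) f))"
    using pvm_inner_self[OF UA f] by (simp add: L2_inner_def)
  finally show ?thesis by (simp add: sums_def tendsto_of_real_iff del: of_real_sum)
qed

text \<open>The set function that defines \<open>spectral_diag\<close> is a measure, so that its values are the intended ones
  and not the default of the measure constructor.\<close>

lemma emeasure_spectral_diag:
  assumes f: "f \<in> L2" and U: "U \<in> sets borel"
  shows "emeasure (spectral_diag E f) U = ennreal (sq_norm lebesgue (E U f))"
proof -
  have eq: "ennreal (Re (spectral_mu E f f U)) = ennreal (sq_norm lebesgue (E U f))" if "U \<in> sets borel" for U
    using pvm_inner_self[OF that f] by (simp add: spectral_mu_def)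
  have "emeasure (spectral_diag E f) U = ennreal (Re (spectral_mu E f f U))"
    unfolding spectral_diag_def
  proof (rule emeasure_measure_of_sigma)
    show "sigma_algebra UNIV (sets borel)" using sets.sigma_algebra_axioms[of borel] by simp
    have "sq_norm lebesgue (E {} f) = 0"
      using pvm_empty[OF f] pvm_L2[of "{}" f] f by (simp add: sq_norm_eq_0_iff_ae)
    then show "positive (sets borel) (\<lambda>U. ennreal (Re (spectral_mu E f f U)))"
      by (simp add: positive_def eq)
    show "countably_additive (sets borel) (\<lambda>U. ennreal (Re (spectral_mu E f f U)))"
    proof (rule countably_additiveI)
      fix A :: "nat \<Rightarrow> real set"
      assume A: "range A \<subseteq> sets borel" "disjoint_family A" "(\<Union>i. A i) \<in> sets borel"
      have "A i \<in> sets borel" for i using A(1) by auto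
      then have "(\<Sum>i. ennreal (Re (spectral_mu E f f (A i)))) = (\<Sum>i. ennreal (sq_norm lebesgue (E (A i) f)))"
        by (intro suminf_cong eq)
      also have "\<dots> = ennreal (sq_norm lebesgue (E (\<Union>i. A i) f))"
        by (rule suminf_ennreal_eq[OF sq_norm_nonneg pvm_sums[OF A(1,2) f]])
      finally show "(\<Sum>i. ennreal (Re (spectral_mu E f f (A i)))) = ennreal (Re (spectral_mu E f f (\<Union>i. A i)))"
        by (simp only: eq[OF A(3)])
    qed
  qed fact
  then show ?thesis using eq[OF U] by simp
qed

lemma measure_spectral_diag:
  assumes "f \<in> L2" "U \<in> sets borel"
  shows "measure (spectral_diag E f) U = sq_norm lebesgue (E U f)"
  using emeasure_spectral_diag[OF assms] by (simp add: measure_def sq_norm_nonneg)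

lemma finite_measure_spectral_diag:
  assumes "f \<in> L2" shows "finite_measure (spectral_diag E f)"
  by (rule finite_measureI) (simp add: space_spectral_diag emeasure_spectral_diag[OF assms])

section \<open>Spectral integrals\<close>

lemma simple_square_integrable:
  assumes "f \<in> L2" and s: "simple_function borel s"
  shows "square_integrable (spectral_diag E f) s"
proof -
  interpret finite_measure "spectral_diag E f" by (rule finite_measure_spectral_diag) fact
  have [measurable]: "s \<in> borel_measurable borel" by (rule borel_measurable_simple_function[OF s])
  have "\<forall>t. (cmod (s t))\<^sup>2 \<le> Max ((\<lambda>c. (cmod c)\<^sup>2) ` range s)"
    using simple_borel_vimage(2)[OF s] by (auto intro!: Max_ge)
  then have "integrable (spectral_diag E f) (\<lambda>t. (cmod (s t))\<^sup>2)"
    by (intro integrable_const_bound[where B = "Max ((\<lambda>c. (cmod c)\<^sup>2) ` range s)"]) auto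
  then show ?thesis by (simp add: square_integrable_def)
qed

lemma simple_spectral_integral_L2:
  assumes "f \<in> L2" "simple_function borel s"
  shows "simple_spectral_integral E s f \<in> L2"
  unfolding simple_spectral_integral_def L2_iff
  by (intro square_integrable_sum square_integrable_cmult)
    (use pvm_L2[OF simple_borel_vimage(1)[OF assms(2)] assms(1)] in \<open>simp add: L2_iff\<close>)

text \<open>Both sides are the double sum of \<open>c (cnj d) \<mu>(s\<^bsup>-1\<^esup>{c} \<inter> r\<^bsup>-1\<^esup>{d})\<close> over the values \<open>c\<close> of \<open>s\<close> and \<open>d\<close> of \<open>r\<close>.\<close>

lemma simple_spectral_integral_inner:
  assumes f: "f \<in> L2" and s: "simple_function borel s" and r: "simple_function borel r"
  shows "L2_inner (simple_spectral_integral E s f) (simple_spectral_integral E r f) =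
    (LINT t|spectral_diag E f. s t * cnj (r t))"
proof -
  let ?\<mu> = "spectral_diag E f"
  interpret finite_measure ?\<mu> by (rule finite_measure_spectral_diag) fact
  note B = simple_borel_vimage[OF s] simple_borel_vimage[OF r]
  let ?ind = "\<lambda>A t. indicator A t :: complex"
  have ind: "square_integrable ?\<mu> (?ind A)" if "A \<in> sets borel" for A
    using that by (intro simple_square_integrable f simple_function_indicator) auto
  have expand: "(\<Sum>c\<in>range s. c * ?ind (s -` {c}) t) = s t" if "finite (range s)" for s :: "real \<Rightarrow> complex" and t
  proof -
    have "(\<Sum>c\<in>range s. c * ?ind (s -` {c}) t) = (\<Sum>c\<in>range s. if c = s t then s t else 0)"
      by (intro sum.cong) (auto simp: indicator_def)
    then show ?thesis using that by simp
  qed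
  have ind_inner: "(LINT t|?\<mu>. ?ind A t * cnj (?ind B t)) = L2_inner (E A f) (E B f)"
    if "A \<in> sets borel" "B \<in> sets borel" for A B
  proof -
    have "(LINT t|?\<mu>. ?ind A t * cnj (?ind B t)) = (LINT t|?\<mu>. complex_of_real (indicator (A \<inter> B) t))"
      by (rule Bochner_Integration.integral_cong) (auto simp: indicator_def)
    also have "\<dots> = of_real (measure ?\<mu> (A \<inter> B))"
      by (simp add: space_spectral_diag)
    also have "\<dots> = L2_inner (E A f) (E B f)"
      using that f by (simp add: measure_spectral_diag pvm_inner pvm_inner_self)
    finally show ?thesis .
  qed
  have "(LINT t|?\<mu>. s t * cnj (r t)) =
      (LINT t|?\<mu>. (\<Sum>c\<in>range s. c * ?ind (s -` {c}) t) * cnj (\<Sum>d\<in>range r. d * ?ind (r -` {d}) t))"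
    by (simp only: expand[OF B(2)] expand[OF B(4)])
  also have "\<dots> = (\<Sum>c\<in>range s. \<Sum>d\<in>range r. c * cnj d * L2_inner (E (s -` {c}) f) (E (r -` {d}) f))"
    by (subst inner_sum) (use B in \<open>auto simp: ind_inner intro!: ind\<close>)
  also have "\<dots> = L2_inner (simple_spectral_integral E s f) (simple_spectral_integral E r f)"
    unfolding L2_inner_def simple_spectral_integral_def
    by (subst inner_sum) (use pvm_L2[OF B(1) f] pvm_L2[OF B(3) f] in \<open>auto simp: L2_iff\<close>)
  finally show ?thesis by simp
qed

text \<open>The defining approximation in a form without extended reals: one simple function at finite distance
  already makes \<open>\<Phi>\<close> square integrable, and then all the distances are finite.\<close>

lemma has_spectral_integral_approx:
  assumes "has_spectral_integral E \<Phi> f h"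
  obtains s where "f \<in> L2" "h \<in> L2" "\<And>n. simple_function borel (s n)"
    "square_integrable (spectral_diag E f) \<Phi>"
    "(\<lambda>n. sq_norm (spectral_diag E f) (\<lambda>t. s n t - \<Phi> t)) \<longlonglongrightarrow> 0"
    "(\<lambda>n. sq_norm lebesgue (\<lambda>x. simple_spectral_integral E (s n) f x - h x)) \<longlonglongrightarrow> 0"
proof -
  let ?\<mu> = "spectral_diag E f"
  obtain s where meas [measurable]: "\<Phi> \<in> borel_measurable borel" and f: "f \<in> L2" "h \<in> L2"
    and s: "\<And>n. simple_function borel (s n)"
    and lim: "(\<lambda>n. \<integral>\<^sup>+t. ennreal ((cmod (s n t - \<Phi> t))\<^sup>2) \<partial>?\<mu>) \<longlonglongrightarrow> 0"
    and lim2: "(\<lambda>n. L2_norm (\<lambda>x. simple_spectral_integral E (s n) f x - h x)) \<longlonglongrightarrow> 0"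
    using assms unfolding has_spectral_integral_def by blast
  have [measurable]: "s n \<in> borel_measurable borel" for n
    by (rule borel_measurable_simple_function[OF s])
  have "\<forall>\<^sub>F n in sequentially. (\<integral>\<^sup>+t. ennreal ((cmod (s n t - \<Phi> t))\<^sup>2) \<partial>?\<mu>) < 1"
    using lim by (rule order_tendstoD) simp
  then obtain n where "(\<integral>\<^sup>+t. ennreal ((cmod (s n t - \<Phi> t))\<^sup>2) \<partial>?\<mu>) < 1"
    using eventually_happens sequentially_bot by blast
  then have "square_integrable ?\<mu> (\<lambda>t. s n t - \<Phi> t)"
    unfolding square_integrable_iff_nn_integral using order_less_trans by fastforce
  from square_integrable_diff[OF simple_square_integrable[OF f(1) s[of n]] this]
  have \<Phi>: "square_integrable ?\<mu> \<Phi>" by simp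
  have "(\<lambda>n. ennreal (sq_norm ?\<mu> (\<lambda>t. s n t - \<Phi> t))) \<longlonglongrightarrow> ennreal 0"
    using lim by (simp add: sq_norm_ennreal[OF square_integrable_diff[OF simple_square_integrable[OF f(1) s] \<Phi>]])
  then have "(\<lambda>n. sq_norm ?\<mu> (\<lambda>t. s n t - \<Phi> t)) \<longlonglongrightarrow> 0"
    by (subst (asm) tendsto_ennreal_iff) (auto simp: sq_norm_nonneg)
  then show thesis using that f s \<Phi> lim2 unfolding L2_norm_tendsto_0_iff by blast
qed

lemma has_spectral_integral_square_integrable:
  "has_spectral_integral E \<Phi> f h \<Longrightarrow> square_integrable (spectral_diag E f) \<Phi>"
  using has_spectral_integral_approx by blast

text \<open>Passage to the limit in \<open>simple_spectral_integral_inner\<close>, by continuity of the inner products of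
  \<open>L\<^sup>2(\<real>\<^sup>d)\<close> and of \<open>L\<^sup>2(\<mu>)\<close>.\<close>

lemma spectral_integral_inner:
  assumes "has_spectral_integral E \<Phi> f h" "has_spectral_integral E \<Psi> f k"
  shows "L2_inner h k = (LINT t|spectral_diag E f. \<Phi> t * cnj (\<Psi> t))"
proof -
  let ?\<mu> = "spectral_diag E f"
  from assms(1) obtain s where f: "f \<in> L2" and h: "h \<in> L2" and s: "\<And>n. simple_function borel (s n)"
    and \<Phi>: "square_integrable ?\<mu> \<Phi>"
    and ls: "(\<lambda>n. sq_norm ?\<mu> (\<lambda>t. s n t - \<Phi> t)) \<longlonglongrightarrow> 0"
      "(\<lambda>n. sq_norm lebesgue (\<lambda>x. simple_spectral_integral E (s n) f x - h x)) \<longlonglongrightarrow> 0"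
    by (rule has_spectral_integral_approx) blast
  from assms(2) obtain r where k: "k \<in> L2" and r: "\<And>n. simple_function borel (r n)"
    and \<Psi>: "square_integrable ?\<mu> \<Psi>"
    and lr: "(\<lambda>n. sq_norm ?\<mu> (\<lambda>t. r n t - \<Psi> t)) \<longlonglongrightarrow> 0"
      "(\<lambda>n. sq_norm lebesgue (\<lambda>x. simple_spectral_integral E (r n) f x - k x)) \<longlonglongrightarrow> 0"
    by (rule has_spectral_integral_approx) blast
  have "(\<lambda>n. L2_inner (simple_spectral_integral E (s n) f) (simple_spectral_integral E (r n) f)) \<longlonglongrightarrow> L2_inner h k"
    unfolding L2_inner_def
    using simple_spectral_integral_L2[OF f s] simple_spectral_integral_L2[OF f r] h k
    by (intro inner_tendsto ls lr) (simp_all add: L2_iff)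
  moreover have "(\<lambda>n. L2_inner (simple_spectral_integral E (s n) f) (simple_spectral_integral E (r n) f))
      \<longlonglongrightarrow> (LINT t|?\<mu>. \<Phi> t * cnj (\<Psi> t))"
    unfolding simple_spectral_integral_inner[OF f s r]
    by (intro inner_tendsto ls lr simple_square_integrable[OF f] s r \<Phi> \<Psi>)
  ultimately show ?thesis by (rule LIMSEQ_unique)
qed

text \<open>Expanding both squares gives double sums that agree term by term. In this form the isometry applies to
  linear combinations of any representatives \<open>h i\<close> of the spectral integrals.\<close>

lemma spectral_integral_sq_norm_sum:
  assumes h: "\<And>i. i \<in> I \<Longrightarrow> has_spectral_integral E (\<Phi> i) f (h i)"
  shows "sq_norm lebesgue (\<lambda>x. \<Sum>i\<in>I. a i * h i x) =
    sq_norm (spectral_diag E f) (\<lambda>t. \<Sum>i\<in>I. a i * \<Phi> i t)"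
proof -
  have "square_integrable lebesgue (h i)" if "i \<in> I" for i
    using h[OF that] by (simp add: has_spectral_integral_def L2_iff)
  moreover have "square_integrable (spectral_diag E f) (\<Phi> i)" if "i \<in> I" for i
    using h[OF that] by (rule has_spectral_integral_square_integrable)
  moreover have "(LINT x|lebesgue. h i x * cnj (h j x)) = (LINT t|spectral_diag E f. \<Phi> i t * cnj (\<Phi> j t))"
    if "i \<in> I" "j \<in> I" for i j
    using spectral_integral_inner[OF h h] that by (simp add: L2_inner_def)
  ultimately have "complex_of_real (sq_norm lebesgue (\<lambda>x. \<Sum>i\<in>I. a i * h i x)) =
    complex_of_real (sq_norm (spectral_diag E f) (\<lambda>t. \<Sum>i\<in>I. a i * \<Phi> i t))"
    unfolding inner_self[symmetric] by (simp add: inner_sum del: cnj_sum)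
  then show ?thesis by (simp only: of_real_eq_iff)
qed

lemma spectral_integral_sq_norm_diff:
  assumes h: "has_spectral_integral E \<Phi> f h" and k: "has_spectral_integral E \<Psi> f k"
  shows "sq_norm lebesgue (\<lambda>x. h x - k x) = sq_norm (spectral_diag E f) (\<lambda>t. \<Phi> t - \<Psi> t)"
  using spectral_integral_sq_norm_sum[of UNIV "\<lambda>i. if i then \<Phi> else \<Psi>" f "\<lambda>i. if i then h else k"
      "\<lambda>i. if i then 1 else - 1"] h k
  by (simp add: UNIV_bool)

lemma simple_has_spectral_integral:
  assumes f: "f \<in> L2" and s: "simple_function borel s"
  shows "has_spectral_integral E s f (simple_spectral_integral E s f)"
  unfolding has_spectral_integral_def
  using assms simple_spectral_integral_L2[OF f s]
  by (intro conjI exI[of _ "\<lambda>n. s"]) (auto simp: L2_norm_def intro: borel_measurable_simple_function)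

text \<open>Simple functions that converge pointwise to \<open>\<Phi>\<close> and are bounded by \<open>2 \<bar>\<Phi>\<bar>\<close> converge in \<open>L\<^sup>2(\<mu>)\<close> by
  dominated convergence. By the isometry their integrals form a Cauchy sequence, which has a limit.\<close>

lemma has_spectral_integral_exists:
  assumes [measurable]: "\<Phi> \<in> borel_measurable borel" and f: "f \<in> L2"
    and \<Phi>: "square_integrable (spectral_diag E f) \<Phi>"
  shows "\<exists>h. has_spectral_integral E \<Phi> f h"
proof -
  let ?\<mu> = "spectral_diag E f"
  obtain s :: "nat \<Rightarrow> real \<Rightarrow> complex" where s: "\<And>n. simple_function borel (s n)"
    and lim: "\<And>t. (\<lambda>n. s n t) \<longlonglongrightarrow> \<Phi> t" and bd: "\<And>n t. cmod (s n t) \<le> 2 * cmod (\<Phi> t)"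
    using borel_measurable_implies_sequence_metric[OF assms(1), of 0] by auto
  have [measurable]: "s n \<in> borel_measurable borel" for n
    by (rule borel_measurable_simple_function[OF s])
  have diff: "square_integrable ?\<mu> (\<lambda>t. s n t - \<Phi> t)" for n
    by (intro square_integrable_diff simple_square_integrable[OF f] s \<Phi>)
  have conv: "(\<lambda>n. sq_norm ?\<mu> (\<lambda>t. s n t - \<Phi> t)) \<longlonglongrightarrow> 0"
  proof -
    have "(\<lambda>n. LINT t|?\<mu>. (cmod (s n t - \<Phi> t))\<^sup>2) \<longlonglongrightarrow> (LINT t|?\<mu>. 0)"
    proof (rule integral_dominated_convergence)
      show "integrable ?\<mu> (\<lambda>t. 9 * (cmod (\<Phi> t))\<^sup>2)"
        using \<Phi> by (simp add: square_integrable_def)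
      show "AE t in ?\<mu>. (\<lambda>n. (cmod (s n t - \<Phi> t))\<^sup>2) \<longlonglongrightarrow> 0"
      proof (rule AE_I2)
        fix t
        have "(\<lambda>n. (cmod (s n t - \<Phi> t))\<^sup>2) \<longlonglongrightarrow> (cmod (\<Phi> t - \<Phi> t))\<^sup>2"
          by (intro tendsto_intros lim)
        then show "(\<lambda>n. (cmod (s n t - \<Phi> t))\<^sup>2) \<longlonglongrightarrow> 0" by simp
      qed
      show "AE t in ?\<mu>. norm ((cmod (s n t - \<Phi> t))\<^sup>2) \<le> 9 * (cmod (\<Phi> t))\<^sup>2" for n
      proof (rule AE_I2)
        fix t
        have "cmod (s n t - \<Phi> t) \<le> 3 * cmod (\<Phi> t)"
          using norm_triangle_ineq4[of "s n t" "\<Phi> t"] bd[of n t] by linarith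
        then have "(cmod (s n t - \<Phi> t))\<^sup>2 \<le> (3 * cmod (\<Phi> t))\<^sup>2" by (rule power_mono) simp
        then show "norm ((cmod (s n t - \<Phi> t))\<^sup>2) \<le> 9 * (cmod (\<Phi> t))\<^sup>2"
          by (simp add: power_mult_distrib)
      qed
    qed measurable
    then show ?thesis by (simp add: sq_norm_def)
  qed
  let ?S = "\<lambda>n. simple_spectral_integral E (s n) f"
  have S: "square_integrable lebesgue (?S n)" for n
    using simple_spectral_integral_L2[OF f s] by (simp add: L2_iff)
  have "\<exists>N. \<forall>i\<ge>N. \<forall>j\<ge>N. sq_norm lebesgue (\<lambda>x. ?S i x - ?S j x) \<le> e" if "e > 0" for e
  proof -
    have "\<forall>\<^sub>F n in sequentially. sq_norm ?\<mu> (\<lambda>t. s n t - \<Phi> t) < e / 4"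
      using conv by (rule order_tendstoD) (use that in simp)
    then obtain N where N: "\<And>n. n \<ge> N \<Longrightarrow> sq_norm ?\<mu> (\<lambda>t. s n t - \<Phi> t) < e / 4"
      by (auto simp: eventually_sequentially)
    have "sq_norm lebesgue (\<lambda>x. ?S i x - ?S j x) \<le> e" if "i \<ge> N" "j \<ge> N" for i j
    proof -
      have "sq_norm ?\<mu> (\<lambda>t. s i t - s j t) \<le> 2 * sq_norm ?\<mu> (\<lambda>t. s i t - \<Phi> t) + 2 * sq_norm ?\<mu> (\<lambda>t. \<Phi> t - s j t)"
        using sq_norm_add_le[OF diff[of i] square_integrable_cmult[OF diff[of j], of "- 1"]] by simp
      also have "\<dots> \<le> e"
        using N[OF that(1)] N[OF that(2)] by (simp add: sq_norm_minus_commute[of ?\<mu> \<Phi>])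
      finally show ?thesis 
        by (simp add: spectral_integral_sq_norm_diff[OF simple_has_spectral_integral[OF f s] simple_has_spectral_integral[OF f s]])
    qed
    then show ?thesis by blast
  qed
  from square_integrable_complete[OF S this] obtain h where h: "square_integrable lebesgue h"
    and lim_h: "(\<lambda>n. sq_norm lebesgue (\<lambda>x. ?S n x - h x)) \<longlonglongrightarrow> 0" by blast
  have "(\<lambda>n. \<integral>\<^sup>+t. ennreal ((cmod (s n t - \<Phi> t))\<^sup>2) \<partial>?\<mu>) \<longlonglongrightarrow> 0"
    using tendsto_ennrealI[OF conv] by (simp add: sq_norm_ennreal[OF diff])
  with f s h lim_h have "has_spectral_integral E \<Phi> f h"
    unfolding has_spectral_integral_def L2_norm_tendsto_0_iff by (auto simp: L2_iff)
  then show ?thesis by blast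
qed

lemma has_spectral_integral_one:
  assumes f: "f \<in> L2"
  shows "has_spectral_integral E (\<lambda>t. 1) f f"
proof -
  have "AE x in lebesgue. E UNIV f x - f x = 0"
    using E f by (simp add: projection_valued_measure_def ae_eq_def)
  moreover have "(\<lambda>x. E UNIV f x - f x) \<in> L2"
    using pvm_L2[OF _ f, of UNIV] f by (simp add: L2_iff square_integrable_diff)
  ultimately have "sq_norm lebesgue (\<lambda>x. E UNIV f x - f x) = 0"
    by (simp add: sq_norm_eq_0_iff_ae ae_eq_def)
  moreover have "simple_spectral_integral E (\<lambda>t. 1) f = E UNIV f"
    by (simp add: simple_spectral_integral_def)
  ultimately have "(\<lambda>n. L2_norm (\<lambda>x. simple_spectral_integral E (\<lambda>t. 1) f x - f x)) \<longlonglongrightarrow> 0"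
    by (simp add: L2_norm_eq)
  then show ?thesis
    unfolding has_spectral_integral_def using f
    by (intro conjI exI[of _ "\<lambda>n t. 1"]) simp_all
qed

lemma has_spectral_integral_cong_AE:
  assumes h: "has_spectral_integral E \<Phi> f h" and [measurable]: "\<Psi> \<in> borel_measurable borel"
    and eq: "AE t in spectral_diag E f. \<Phi> t = \<Psi> t"
  shows "has_spectral_integral E \<Psi> f h"
proof -
  have "(\<integral>\<^sup>+t. ennreal ((cmod (s t - \<Phi> t))\<^sup>2) \<partial>spectral_diag E f) =
      (\<integral>\<^sup>+t. ennreal ((cmod (s t - \<Psi> t))\<^sup>2) \<partial>spectral_diag E f)" for s
    by (rule nn_integral_cong_AE) (use eq in eventually_elim, simp)
  with h show ?thesis unfolding has_spectral_integral_def by simp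
qed

end

section \<open>The spectral measure lives on the positive half-line\<close>

text \<open>Needed because the Bochner integral of a nonmeasurable function is \<open>0\<close>: without it the potential term of
  the form could vanish for a trivial reason.\<close>

lemma locally_integrable_measurable:
  fixes V :: "real ^ 'n \<Rightarrow> real"
  assumes "locally_integrable V" shows "V \<in> borel_measurable lebesgue"
proof (rule borel_measurable_LIMSEQ_metric)
  fix i :: nat
  have "set_integrable lebesgue (cball 0 (real i)) V"
    using assms by (simp add: locally_integrable_def)
  then show "(\<lambda>x. indicator (cball 0 (real i)) x *\<^sub>R V x) \<in> borel_measurable lebesgue"
    unfolding set_integrable_def by (rule borel_measurable_integrable)
next
  fix x :: "real ^ 'n"
  obtain N :: nat where "norm x \<le> real N" using real_arch_simple by blast
  then have "\<forall>\<^sub>F i in sequentially. indicator (cball 0 (real i)) x *\<^sub>R V x = V x"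
    by (intro eventually_sequentiallyI[of N]) (auto simp: indicator_def)
  then show "(\<lambda>i. indicator (cball 0 (real i)) x *\<^sub>R V x) \<longlonglongrightarrow> V x"
    by (rule tendsto_eventually)
qed

text \<open>The gradient term of the form is nonnegative and the potential term is the squared norm of
  \<open>\<surd>V g\<close>, which must therefore vanish.\<close>

lemma form_self_nonpos_imp_zero:
  fixes V :: "real ^ 'n \<Rightarrow> real"
  assumes V: "locally_integrable V" "AE x in lebesgue. V x > 0"
    and g: "g \<in> form_dom V" and neg: "Re (form V g g) \<le> 0"
  shows "ae_eq g (\<lambda>x. 0)"
proof -
  have [measurable]: "V \<in> borel_measurable lebesgue" by (rule locally_integrable_measurable[OF V(1)])
  have [measurable]: "g \<in> borel_measurable lebesgue" using g by (simp add: form_dom_def L2_def)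
  let ?w = "\<lambda>x. of_real (sqrt (V x)) * g x :: complex"
  have w: "?w \<in> L2" using g by (simp add: form_dom_def)
  have "(LINT x|lebesgue. (\<Sum>i\<in>UNIV. weak_partial i g x * cnj (weak_partial i g x))) =
      (LINT x|lebesgue. complex_of_real (\<Sum>i\<in>UNIV. (cmod (weak_partial i g x))\<^sup>2))"
    by (simp add: complex_norm_square del: of_real_power)
  also have "Re \<dots> \<ge> 0"
    by (simp only: integral_complex_of_real Re_complex_of_real) (intro integral_nonneg_AE AE_I2 sum_nonneg, simp)
  finally have grad: "0 \<le> Re (LINT x|lebesgue. (\<Sum>i\<in>UNIV. weak_partial i g x * cnj (weak_partial i g x)))" .
  have "(LINT x|lebesgue. of_real (V x) * g x * cnj (g x)) = (LINT x|lebesgue. ?w x * cnj (?w x))"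
  proof (rule integral_cong_AE)
    show "AE x in lebesgue. of_real (V x) * g x * cnj (g x) = ?w x * cnj (?w x)"
      using V(2)
    proof eventually_elim
      case (elim x)
      have "complex_of_real (V x) = of_real (sqrt (V x)) * of_real (sqrt (V x))"
        unfolding of_real_mult[symmetric] using elim by simp
      then show ?case by (simp add: mult_ac)
    qed
  qed measurable
  then have "Re (LINT x|lebesgue. of_real (V x) * g x * cnj (g x)) = sq_norm lebesgue ?w"
    by (simp only: inner_self Re_complex_of_real)
  with grad neg have "sq_norm lebesgue ?w = 0"
    using sq_norm_nonneg[of lebesgue ?w] by (simp add: form_def)
  then have "AE x in lebesgue. ?w x = 0"
    using w by (simp add: sq_norm_eq_0_iff_ae ae_eq_def)
  with V(2) show ?thesis
    unfolding ae_eq_def by eventually_elim auto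
qed

text \<open>The identity is bounded on \<open>[-n,0]\<close>, so the projected vector lies in the domain of the operator, and
  there the form is the first moment of a measure supported in \<open>[-n,0]\<close>.\<close>

lemma spectral_measure_of_bounded_nonpos:
  fixes V :: "real ^ 'n \<Rightarrow> real"
  assumes V: "locally_integrable V" "AE x in lebesgue. V x > 0"
    and EV: "spectral_measure_of V E" and f: "f \<in> L2"
  shows "ae_eq (E {- real n..0} f) (\<lambda>x. 0)"
proof -
  have E: "projection_valued_measure E" using EV by (simp add: spectral_measure_of_def)
  let ?U = "{- real n..0}"
  define g where "g = E ?U f"
  have g: "g \<in> L2" unfolding g_def using f by (intro pvm_L2[OF E]) auto
  let ?\<mu> = "spectral_diag E g"
  interpret finite_measure ?\<mu> by (rule finite_measure_spectral_diag[OF E g])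
  have "ae_eq (E (- ?U \<inter> ?U) f) (E (- ?U) g)"
    unfolding g_def using f by (intro pvm_Int[OF E]) simp_all
  moreover have "ae_eq (E {} f) (\<lambda>x. 0)"
    by (rule pvm_empty[OF E f])
  ultimately have "AE x in lebesgue. E (- ?U) g x = 0"
    unfolding ae_eq_def Compl_disjoint2 by eventually_elim simp
  then have "sq_norm lebesgue (E (- ?U) g) = 0"
    using pvm_L2[OF E _ g, of "- ?U"] by (simp add: sq_norm_eq_0_iff_ae ae_eq_def)
  then have "emeasure ?\<mu> (- ?U) = 0"
    by (simp add: emeasure_spectral_diag[OF E g])
  then have supp: "AE t in ?\<mu>. t \<in> ?U"
    by (intro AE_I[of _ _ "- ?U"]) (auto simp: sets_spectral_diag)
  have "integrable ?\<mu> (\<lambda>t. (cmod (of_real t))\<^sup>2)"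
  proof (rule integrable_const_bound)
    show "AE t in ?\<mu>. norm ((cmod (of_real t))\<^sup>2) \<le> (real n)\<^sup>2"
      using supp by eventually_elim (auto intro!: power2_mono simp: abs_le_square_iff[symmetric])
  qed measurable
  then have "square_integrable ?\<mu> of_real"
    by (simp add: square_integrable_def)
  then obtain h where h: "has_spectral_integral E of_real g h"
    using has_spectral_integral_exists[OF E _ g] by fastforce
  then have op: "schroedinger_op V g h"
    using EV by (simp add: spectral_measure_of_def)
  have "form V g g = L2_inner h g"
    using op by (simp add: schroedinger_op_def)
  also have "\<dots> = (LINT t|?\<mu>. of_real t * cnj 1)"
    by (rule spectral_integral_inner[OF E h has_spectral_integral_one[OF E g]])
  also have "\<dots> = of_real (LINT t|?\<mu>. t)"
    by simp
  finally have "Re (form V g g) = (LINT t|?\<mu>. t)" by simp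
  moreover have "0 \<le> (LINT t|?\<mu>. - t)"
    by (rule integral_nonneg_AE) (use supp in eventually_elim, simp)
  ultimately have "Re (form V g g) \<le> 0" by simp
  moreover have "g \<in> form_dom V" using op by (simp add: schroedinger_op_def)
  ultimately show ?thesis
    using form_self_nonpos_imp_zero[OF V] by (simp add: g_def)
qed

lemma spectral_diag_positive:
  fixes V :: "real ^ 'n \<Rightarrow> real"
  assumes V: "locally_integrable V" "AE x in lebesgue. V x > 0"
    and EV: "spectral_measure_of V E" and f: "f \<in> L2"
  shows "AE t in spectral_diag E f. 0 < t"
proof -
  have E: "projection_valued_measure E" using EV by (simp add: spectral_measure_of_def)
  have "AE t in spectral_diag E f. t \<notin> {- real n..0}" for n
  proof (rule AE_not_in)
    have "sq_norm lebesgue (E {- real n..0} f) = 0"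
      using spectral_measure_of_bounded_nonpos[OF V EV f] pvm_L2[OF E _ f]
      by (simp add: sq_norm_eq_0_iff_ae)
    then show "{- real n..0} \<in> null_sets (spectral_diag E f)"
      by (simp add: null_sets_def sets_spectral_diag emeasure_spectral_diag[OF E f])
  qed
  then have "AE t in spectral_diag E f. \<forall>n. t \<notin> {- real n..0}"
    by (intro AE_all_countable[THEN iffD2] allI)
  then show ?thesis
  proof eventually_elim
    case (elim t)
    obtain n :: nat where "- t \<le> real n" using real_arch_simple by blast
    with elim[rule_format, of n] show ?case by auto
  qed
qed

section \<open>Taylor remainders of the exponential function\<close>

text \<open>The intermediate point of the Lagrange remainder lies between \<open>0\<close> and \<open>x\<close>, on the side of \<open>x\<close>. The sign
  matters: a bound with \<open>e\<^bsup>\<bar>x\<bar>\<^esup>\<close> would bring in negative powers of \<open>\<lambda>\<close>, which membership in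
  the domain of a positive power does not control.\<close>

lemma exp_Taylor_remainder_le:
  fixes x :: real
  shows "\<bar>exp x - (\<Sum>k\<le>m. x ^ k / fact k)\<bar> \<le> \<bar>x\<bar> ^ Suc m / fact (Suc m) * max 1 (exp x)"
proof -
  have D: "\<forall>k t. k < Suc m \<and> P t \<longrightarrow> DERIV exp t :> exp (t :: real)" for P
    by (auto intro: DERIV_exp)
  have "\<exists>t. (t \<le> 0 \<or> t \<le> x) \<and> exp x = (\<Sum>k<Suc m. exp 0 / fact k * x ^ k) + exp t / fact (Suc m) * x ^ Suc m"
  proof (cases x "0 :: real" rule: linorder_cases)
    case less
    then show ?thesis
      using Maclaurin_minus[of x "Suc m" "\<lambda>_. exp" exp] D[of "\<lambda>t. x \<le> t \<and> t \<le> 0"] by (force simp del: power_Suc fact_Suc)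
  next
    case equal
    then show ?thesis by (intro exI[of _ 0]) (simp add: lessThan_Suc_eq_insert_0 sum.reindex)
  next
    case greater
    then show ?thesis
      using Maclaurin[of x "Suc m" "\<lambda>_. exp" exp] D[of "\<lambda>t. 0 \<le> t \<and> t \<le> x"] by (force simp del: power_Suc fact_Suc)
  qed
  then obtain t where t: "t \<le> 0 \<or> t \<le> x"
    and e: "exp x = (\<Sum>k<Suc m. exp 0 / fact k * x ^ k) + exp t / fact (Suc m) * x ^ Suc m" by blast
  have "exp x - (\<Sum>k\<le>m. x ^ k / fact k) = exp t / fact (Suc m) * x ^ Suc m"
    using e by (simp add: lessThan_Suc_atMost del: power_Suc fact_Suc)
  then have "\<bar>exp x - (\<Sum>k\<le>m. x ^ k / fact k)\<bar> = \<bar>x\<bar> ^ Suc m / fact (Suc m) * exp t"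
    by (simp add: abs_mult power_abs del: power_Suc fact_Suc)
  also have "\<dots> \<le> \<bar>x\<bar> ^ Suc m / fact (Suc m) * max 1 (exp x)"
    using t by (intro mult_left_mono) (auto simp: le_max_iff_disj simp del: power_Suc fact_Suc)
  finally show ?thesis .
qed

lemma power_le_fact_exp:
  fixes y :: real
  assumes "0 \<le> y" shows "y ^ n \<le> fact n * exp y"
proof -
  obtain t where "exp y = (\<Sum>k<Suc n. y ^ k / fact k) + exp t / fact (Suc n) * y ^ Suc n"
    using Maclaurin_exp_le[of y "Suc n"] by blast
  moreover have "0 \<le> (\<Sum>k<n. y ^ k / fact k)" "0 \<le> exp t / fact (Suc n) * y ^ Suc n"
    using assms by (auto intro!: sum_nonneg simp del: power_Suc fact_Suc)
  ultimately have "y ^ n / fact n \<le> exp y"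
    by (simp del: power_Suc fact_Suc)
  then show ?thesis by (simp add: field_simps)
qed

text \<open>For \<open>y > 0\<close> the exponent \<open>s0 y\<close> is split into halves: one absorbs \<open>y\<^bsup>m+1\<^esup>\<close> at the price of
  \<open>(2/s0)\<^bsup>m+1\<^esup>\<close>, the other dominates \<open>e\<^bsup>sy\<^esup>\<close> since \<open>s \<le> s0/2\<close>.\<close>

lemma exp_scaled_Taylor_remainder_le:
  fixes y s s0 :: real
  assumes s: "0 < s" "2 * s \<le> s0"
  shows "\<bar>exp (s * y) - (\<Sum>k\<le>m. (s * y) ^ k / fact k)\<bar> \<le>
    s ^ Suc m * (1 + (2 / s0) ^ Suc m) * (\<bar>y\<bar> ^ Suc m + exp (s0 * y))"
proof -
  have "\<bar>y\<bar> ^ Suc m / fact (Suc m) * max 1 (exp (s * y)) \<le> (1 + (2 / s0) ^ Suc m) * (\<bar>y\<bar> ^ Suc m + exp (s0 * y))"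
  proof (cases "y \<le> 0")
    case True
    then have "s * y \<le> 0" using s by (simp add: mult_nonneg_nonpos)
    then have "max 1 (exp (s * y)) = 1" by (simp add: max_absorb1)
    moreover have "\<bar>y\<bar> ^ Suc m / fact (Suc m) \<le> \<bar>y\<bar> ^ Suc m / 1"
      by (intro divide_left_mono fact_ge_1) (simp_all del: fact_Suc power_Suc)
    moreover have "1 * (\<bar>y\<bar> ^ Suc m + 0) \<le> (1 + (2 / s0) ^ Suc m) * (\<bar>y\<bar> ^ Suc m + exp (s0 * y))"
      using s by (intro mult_mono add_mono) (simp_all del: power_Suc)
    ultimately show ?thesis by (simp del: power_Suc fact_Suc)
  next
    case False
    have "(s0 / 2 * y) ^ Suc m \<le> fact (Suc m) * exp (s0 / 2 * y)"
      using False s by (intro power_le_fact_exp) simp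
    then have "(2 / s0) ^ Suc m * (s0 / 2 * y) ^ Suc m \<le> (2 / s0) ^ Suc m * (fact (Suc m) * exp (s0 / 2 * y))"
      using s by (intro mult_left_mono) simp_all
    also have "(2 / s0) ^ Suc m * (s0 / 2 * y) ^ Suc m = \<bar>y\<bar> ^ Suc m"
      unfolding power_mult_distrib[symmetric] using s False by simp
    finally have "\<bar>y\<bar> ^ Suc m / fact (Suc m) \<le> (2 / s0) ^ Suc m * exp (s0 / 2 * y)"
      by (simp add: divide_le_eq mult_ac del: power_Suc fact_Suc)
    moreover have "max 1 (exp (s * y)) \<le> exp (s0 / 2 * y)"
      using s False by (simp add: mult_right_mono)
    ultimately have "\<bar>y\<bar> ^ Suc m / fact (Suc m) * max 1 (exp (s * y)) \<le> (2 / s0) ^ Suc m * exp (s0 / 2 * y) * exp (s0 / 2 * y)"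
      using s by (intro mult_mono) (simp_all del: power_Suc fact_Suc)
    also have "\<dots> = (2 / s0) ^ Suc m * exp (s0 * y)"
      by (simp add: mult.assoc del: power_Suc flip: exp_add)
    also have "\<dots> \<le> (1 + (2 / s0) ^ Suc m) * (\<bar>y\<bar> ^ Suc m + exp (s0 * y))"
      using s by (intro mult_mono) (simp_all del: power_Suc)
    finally show ?thesis .
  qed
  then have "s ^ Suc m * (\<bar>y\<bar> ^ Suc m / fact (Suc m) * max 1 (exp (s * y))) \<le>
      s ^ Suc m * ((1 + (2 / s0) ^ Suc m) * (\<bar>y\<bar> ^ Suc m + exp (s0 * y)))"
    using s by (intro mult_left_mono) simp_all
  with exp_Taylor_remainder_le[of "s * y" m] show ?thesis
    using s by (simp add: abs_mult power_mult_distrib mult.assoc del: power_Suc fact_Suc)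
qed

section \<open>Domains of powers and logarithms, and the expansion\<close>

context
  fixes E :: "real set \<Rightarrow> (real ^ 'n \<Rightarrow> complex) \<Rightarrow> real ^ 'n \<Rightarrow> complex"
  assumes E: "projection_valued_measure E"
begin

lemma calc_dom_iff:
  assumes [measurable]: "\<Phi> \<in> borel_measurable borel"
  shows "f \<in> calc_dom E \<Phi> \<longleftrightarrow>
    f \<in> L2 \<and> square_integrable (spectral_diag E f) (\<lambda>t. indicator {0<..} t * \<Phi> t)"
proof -
  have "(\<integral>\<^sup>+t\<in>{0<..}. ennreal ((cmod (\<Phi> t))\<^sup>2) \<partial>spectral_diag E f) =
      (\<integral>\<^sup>+t. ennreal ((cmod (indicator {0<..} t * \<Phi> t))\<^sup>2) \<partial>spectral_diag E f)"
    by (rule nn_integral_cong) (simp add: indicator_def)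
  then show ?thesis
    unfolding calc_dom_def square_integrable_iff_nn_integral by simp
qed

text \<open>Existence of the spectral integral makes the choice in the definition of \<open>calc\<close> meaningful.\<close>

lemma has_spectral_integral_calc:
  assumes [measurable]: "\<Phi> \<in> borel_measurable borel" and f: "f \<in> calc_dom E \<Phi>"
  shows "has_spectral_integral E (\<lambda>t. indicator {0<..} t * \<Phi> t) f (calc E \<Phi> f)"
proof -
  have "\<exists>h. has_spectral_integral E (\<lambda>t. indicator {0<..} t * \<Phi> t) f h"
    using f by (intro has_spectral_integral_exists[OF E]) (simp_all add: calc_dom_iff)
  then show ?thesis unfolding calc_def by (rule someI_ex)
qed

text \<open>Constants are square integrable since the spectral measure of a vector is finite; hence domination is
  only needed where \<open>\<bar>\<Psi>\<bar> > 1\<close>.\<close>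

lemma calc_dom_dominated:
  assumes f: "f \<in> calc_dom E \<Phi>" and [measurable]: "\<Phi> \<in> borel_measurable borel" "\<Psi> \<in> borel_measurable borel"
    and le: "\<And>t. 0 < t \<Longrightarrow> cmod (\<Psi> t) \<le> 1 \<or> cmod (\<Psi> t) \<le> cmod (\<Phi> t)"
  shows "f \<in> calc_dom E \<Psi>"
proof -
  let ?\<mu> = "spectral_diag E f"
  have f2: "f \<in> L2" and \<Phi>: "square_integrable ?\<mu> (\<lambda>t. indicator {0<..} t * \<Phi> t)"
    using f by (simp_all add: calc_dom_iff)
  interpret finite_measure ?\<mu> by (rule finite_measure_spectral_diag[OF E f2])
  have "integrable ?\<mu> (\<lambda>t. (cmod (indicator {0<..} t * \<Psi> t))\<^sup>2)"
  proof (rule Bochner_Integration.integrable_bound[of _ "\<lambda>t. 1 + (cmod (indicator {0<..} t * \<Phi> t))\<^sup>2"])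
    show "integrable ?\<mu> (\<lambda>t. 1 + (cmod (indicator {0<..} t * \<Phi> t))\<^sup>2)"
      using \<Phi> by (simp add: square_integrable_def)
    have "(cmod (\<Psi> t))\<^sup>2 \<le> 1 + (cmod (\<Phi> t))\<^sup>2" if "0 < t" for t
      using le[OF that]
    proof
      assume "cmod (\<Psi> t) \<le> 1"
      then have "(cmod (\<Psi> t))\<^sup>2 \<le> 1" by (simp add: power_le_one)
      then show ?thesis by (simp add: add_increasing2)
    next
      assume "cmod (\<Psi> t) \<le> cmod (\<Phi> t)"
      then have "(cmod (\<Psi> t))\<^sup>2 \<le> (cmod (\<Phi> t))\<^sup>2" by (simp add: power_mono)
      then show ?thesis by linarith
    qed
    then show "AE t in ?\<mu>. norm ((cmod (indicator {0<..} t * \<Psi> t))\<^sup>2) \<le>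
        norm (1 + (cmod (indicator {0<..} t * \<Phi> t))\<^sup>2)"
      by (intro AE_I2) (simp add: indicator_def)
  qed measurable
  then show ?thesis
    using f2 by (simp add: calc_dom_iff square_integrable_def)
qed

lemma log_power_dom_le:
  assumes f: "f \<in> log_power_dom E (Suc m)" and k: "k \<le> Suc m"
  shows "f \<in> log_power_dom E k"
proof (cases "k = 0")
  case True
  then show ?thesis using f by (simp add: log_power_dom_def calc_dom_def)
next
  case False
  have "f \<in> calc_dom E (\<lambda>t. of_real (ln t ^ k))"
  proof (rule calc_dom_dominated)
    show "f \<in> calc_dom E (\<lambda>t. of_real (ln t ^ Suc m))"
      using f by (simp add: log_power_dom_def)
    fix t :: real
    show "cmod (of_real (ln t ^ k)) \<le> 1 \<or> cmod (of_real (ln t ^ k)) \<le> cmod (of_real (ln t ^ Suc m))"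
    proof (cases "\<bar>ln t\<bar> \<le> 1")
      case True
      then have "\<bar>ln t\<bar> ^ k \<le> 1" by (simp add: power_le_one)
      then show ?thesis by (simp add: norm_power)
    next
      case False
      then have "\<bar>ln t\<bar> ^ k \<le> \<bar>ln t\<bar> ^ Suc m" by (intro power_increasing k) simp
      then show ?thesis by (simp add: norm_power norm_mult abs_mult power_abs)
    qed
  qed measurable
  then show ?thesis using False by (simp add: log_power_dom_def)
qed

lemma pow_dom_between:
  assumes f: "f \<in> pow_dom E (\<sigma> * s0)" and s: "0 < s" "s \<le> s0"
  shows "f \<in> pow_dom E (\<sigma> * s)"
  unfolding pow_dom_def
proof (rule calc_dom_dominated)
  show "f \<in> calc_dom E (\<lambda>t. of_real (t powr (\<sigma> * s0)))" using f by (simp add: pow_dom_def)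
  fix t :: real assume t: "0 < t"
  show "cmod (of_real (t powr (\<sigma> * s))) \<le> 1 \<or>
      cmod (of_real (t powr (\<sigma> * s))) \<le> cmod (of_real (t powr (\<sigma> * s0)))"
  proof (cases "\<sigma> * ln t \<le> 0")
    case True
    then have "s * (\<sigma> * ln t) \<le> 0" using s by (simp add: mult_nonneg_nonpos)
    then show ?thesis using t by (simp add: powr_def mult_ac)
  next
    case False
    then have "s * (\<sigma> * ln t) \<le> s0 * (\<sigma> * ln t)" using s by (intro mult_right_mono) auto
    then show ?thesis using t by (simp add: powr_def mult_ac)
  qed
qed measurable

text \<open>For \<open>k = 0\<close> the operator is the identity by convention, which corresponds to \<open>\<Phi> = 1\<close> on the whole line. It
  agrees with the integral over \<open>(0,\<infinity>)\<close> only because of the hypothesis on the spectral measure.\<close>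

lemma has_spectral_integral_log_power:
  assumes f: "f \<in> log_power_dom E k" and pos: "AE t in spectral_diag E f. 0 < t"
  shows "has_spectral_integral E (\<lambda>t. indicator {0<..} t * of_real (ln t ^ k)) f (log_power E k f)"
proof (cases "k = 0")
  case True
  have "has_spectral_integral E (\<lambda>t. 1) f f"
    using f True by (intro has_spectral_integral_one[OF E]) (simp add: log_power_dom_def)
  then have "has_spectral_integral E (\<lambda>t. indicator {0<..} t * of_real (ln t ^ k)) f f"
  proof (rule has_spectral_integral_cong_AE[OF E])
    show "AE t in spectral_diag E f. 1 = indicator {0<..} t * complex_of_real (ln t ^ k)"
      using pos by eventually_elim (simp add: True)
  qed measurable
  then show ?thesis by (simp add: True log_power_def)
next
  case False
  then show ?thesis
    using has_spectral_integral_calc[of "\<lambda>t. of_real (ln t ^ k)" f] f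
    by (simp add: log_power_dom_def log_power_def)
qed

text \<open>The remainder is a linear combination of the spectral integrals of \<open>log\<^sup>k\<close> for \<open>k \<le> m\<close> and of one power,
  so its squared norm is the integral of the squared scalar remainder, which is at most a constant times
  \<open>s\<^bsup>2(m+1)\<^esup>\<close>.\<close>

lemma log_expansion_of_powers:
  assumes pos: "AE t in spectral_diag E f. 0 < t" and \<sigma>: "\<bar>\<sigma>\<bar> = 1" and s0: "0 < s0"
    and fl: "f \<in> log_power_dom E (Suc m)" and fp: "f \<in> pow_dom E (\<sigma> * s0)"
  shows "L2_small_o (\<lambda>s x. pow_op E (\<sigma> * s) f x
    - (\<Sum>k=0..m. of_real (\<sigma> ^ k * (s ^ k / fact k)) * log_power E k f x)) m"
    (is "L2_small_o ?F m")
proof -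
  let ?\<mu> = "spectral_diag E f"
  let ?L = "\<lambda>k t. indicator {0<..} t * complex_of_real (ln t ^ k)"
  let ?P = "\<lambda>s t. indicator {0<..} t * complex_of_real (t powr (\<sigma> * s))"
  define K where "K = 2 * sq_norm ?\<mu> (?L (Suc m)) + 2 * sq_norm ?\<mu> (?P s0)"
  define C where "C = 1 + (2 / s0) ^ Suc m"
  have C: "0 \<le> C" using s0 by (simp add: C_def)
  have K: "0 \<le> K" by (simp add: K_def sq_norm_nonneg)
  have Lint: "has_spectral_integral E (?L k) f (log_power E k f)" if "k \<le> Suc m" for k
    by (intro has_spectral_integral_log_power log_power_dom_le[OF fl that] pos)
  have Pint: "has_spectral_integral E (?P s) f (pow_op E (\<sigma> * s) f)" if "0 < s" "s \<le> s0" for s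
    unfolding pow_op_def
    by (rule has_spectral_integral_calc) (use pow_dom_between[OF fp that] in \<open>simp_all add: pow_dom_def\<close>)
  have key: "?F s \<in> L2 \<and> sq_norm lebesgue (?F s) \<le> (s ^ Suc m * C)\<^sup>2 * K" if s: "0 < s" "2 * s \<le> s0" for s
  proof -
    \<comment> \<open>All terms are put into one sum over \<open>{0..m+1}\<close>; the index \<open>m+1\<close> stands for the power.\<close>
    let ?a = "\<lambda>i. if i \<le> m then - complex_of_real (\<sigma> ^ i * (s ^ i / fact i)) else 1"
    let ?h = "\<lambda>i. if i \<le> m then log_power E i f else pow_op E (\<sigma> * s) f"
    let ?\<Phi> = "\<lambda>i. if i \<le> m then ?L i else ?P s"
    have hint: "has_spectral_integral E (?\<Phi> i) f (?h i)" for i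
      using Lint[of i] Pint[of s] s by simp
    have F: "?F s = (\<lambda>x. \<Sum>i\<in>{0..Suc m}. ?a i * ?h i x)"
      by (simp add: sum_negf fun_eq_iff)
    have "?F s \<in> L2"
      unfolding F L2_iff
      by (intro square_integrable_sum square_integrable_cmult)
        (use hint in \<open>simp only: has_spectral_integral_def L2_iff\<close>)
    let ?R = "\<lambda>t. \<Sum>i\<in>{0..Suc m}. ?a i * ?\<Phi> i t"
    have R: "square_integrable ?\<mu> ?R"
      by (intro square_integrable_sum square_integrable_cmult has_spectral_integral_square_integrable[OF E hint])
    have sL: "square_integrable ?\<mu> (?L (Suc m))" and sP: "square_integrable ?\<mu> (?P s0)"
      using has_spectral_integral_square_integrable[OF E Lint[of "Suc m"]]
        has_spectral_integral_square_integrable[OF E Pint[of s0]] s0 by simp_all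
    have R_le: "(cmod (?R t))\<^sup>2 \<le> (s ^ Suc m * C)\<^sup>2 * (2 * (cmod (?L (Suc m) t))\<^sup>2 + 2 * (cmod (?P s0 t))\<^sup>2)" for t
    proof (cases "0 < t")
      case True
      define y where "y = \<sigma> * ln t"
      have "?R t = of_real (t powr (\<sigma> * s)) - (\<Sum>k=0..m. of_real (\<sigma> ^ k * (s ^ k / fact k)) * of_real (ln t ^ k))"
        using True by (simp add: sum_negf)
      also have "\<dots> = of_real (exp (s * y) - (\<Sum>k\<le>m. (s * y) ^ k / fact k))"
        using True by (simp add: y_def powr_def power_mult_distrib mult_ac atLeast0AtMost)
      finally have "cmod (?R t) = \<bar>exp (s * y) - (\<Sum>k\<le>m. (s * y) ^ k / fact k)\<bar>"
        by (simp only: norm_of_real)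
      also have "\<dots> \<le> s ^ Suc m * C * (\<bar>y\<bar> ^ Suc m + exp (s0 * y))"
        unfolding C_def by (rule exp_scaled_Taylor_remainder_le[OF s])
      finally have "(cmod (?R t))\<^sup>2 \<le> (s ^ Suc m * C)\<^sup>2 * (\<bar>y\<bar> ^ Suc m + exp (s0 * y))\<^sup>2"
        unfolding power_mult_distrib[symmetric] by (rule power_mono) simp
      also have "(\<bar>y\<bar> ^ Suc m + exp (s0 * y))\<^sup>2 \<le> 2 * (\<bar>y\<bar> ^ Suc m)\<^sup>2 + 2 * (exp (s0 * y))\<^sup>2"
        using norm_add_sq_le[of "of_real (\<bar>y\<bar> ^ Suc m)" "of_real (exp (s0 * y))"]
        by (simp del: of_real_power power_Suc flip: of_real_add)
      also have "\<bar>y\<bar> ^ Suc m = cmod (?L (Suc m) t)"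
        using True \<sigma> by (simp add: y_def abs_mult norm_mult norm_power)
      also have "exp (s0 * y) = cmod (?P s0 t)"
        using True by (simp add: y_def powr_def mult_ac)
      finally show ?thesis by (simp add: mult_left_mono)
    qed simp
    have "sq_norm lebesgue (?F s) = sq_norm ?\<mu> ?R"
      unfolding F by (rule spectral_integral_sq_norm_sum[OF E hint])
    also have "\<dots> \<le> (LINT t|?\<mu>. (s ^ Suc m * C)\<^sup>2 * (2 * (cmod (?L (Suc m) t))\<^sup>2 + 2 * (cmod (?P s0 t))\<^sup>2))"
      unfolding sq_norm_def
      by (intro integral_mono R_le square_integrable_integrable[OF R] integrable_mult_right
          Bochner_Integration.integrable_add square_integrable_integrable[OF sL] square_integrable_integrable[OF sP])
    also have "\<dots> = (s ^ Suc m * C)\<^sup>2 * K"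
      using square_integrable_integrable[OF sL] square_integrable_integrable[OF sP]
      by (simp add: K_def sq_norm_def del: of_real_power power_Suc)
    finally show ?thesis using \<open>?F s \<in> L2\<close> by blast
  qed
  have small: "\<forall>\<^sub>F s in at_right 0. 0 < s \<and> 2 * s \<le> s0"
    unfolding eventually_at_right_field using s0 by (intro exI[of _ "s0 / 2"]) auto
  show ?thesis
    unfolding L2_small_o_def
  proof
    show "\<forall>\<^sub>F s in at_right 0. ?F s \<in> L2"
      using small by eventually_elim (use key in blast)
    have lim: "((\<lambda>s. s * (C * sqrt K)) \<longlongrightarrow> 0) (at_right 0)"
      by (auto intro!: tendsto_eq_intros)
    have "\<forall>\<^sub>F s in at_right 0. norm (L2_norm (?F s) / s ^ m) \<le> s * (C * sqrt K)"
      using small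
    proof eventually_elim
      case (elim s)
      then have "L2_norm (?F s) \<le> sqrt ((s ^ Suc m * C)\<^sup>2 * K)"
        using key[of s] unfolding L2_norm_eq by (intro real_sqrt_le_mono) blast
      also have "\<dots> = s ^ Suc m * C * sqrt K"
        using elim C by (simp add: real_sqrt_mult)
      finally show ?case
        using elim by (simp add: L2_norm_eq sq_norm_nonneg divide_le_eq mult_ac)
    qed
    then show "((\<lambda>s. L2_norm (?F s) / s ^ m) \<longlongrightarrow> 0) (at_right 0)"
      by (rule Lim_null_comparison[OF _ lim])
  qed
qed

end

theorem theorem1p1:
  fixes V :: "real ^ 'n \<Rightarrow> real"
    and E :: "real set \<Rightarrow> (real ^ 'n \<Rightarrow> complex) \<Rightarrow> real ^ 'n \<Rightarrow> complex"
    and m :: nat and s0 :: real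
  assumes "0 < s0" and "s0 \<le> 1"
    and "locally_integrable V"
    and "AE x in lebesgue. V x > 0"
    and "spectral_measure_of V E"
  shows "(\<forall>f \<in> log_power_dom E (m + 1) \<inter> pow_dom E s0.
            (\<forall>s \<in> {0<..s0}. f \<in> pow_dom E s) \<and> (\<forall>k\<le>m. f \<in> log_power_dom E k) \<and>
            L2_small_o (\<lambda>s x. pow_op E s f x
                - (\<Sum>k=0..m. of_real (s ^ k / fact k) * log_power E k f x)) m) \<and>
         (\<forall>f \<in> log_power_dom E (m + 1) \<inter> pow_dom E (- s0).
            (\<forall>s \<in> {0<..s0}. f \<in> pow_dom E (- s)) \<and> (\<forall>k\<le>m. f \<in> log_power_dom E k) \<and>
            L2_small_o (\<lambda>s x. pow_op E (- s) f x
                - (\<Sum>k=0..m. of_real ((- 1) ^ k * (s ^ k / fact k)) * log_power E k f x)) m)"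
proof -
  have E: "projection_valued_measure E"
    using assms(5) by (simp add: spectral_measure_of_def)
  have pos: "AE t in spectral_diag E f. 0 < t" if "f \<in> log_power_dom E (Suc m)" for f
    using that by (intro spectral_diag_positive[OF assms(3-5)]) (simp add: log_power_dom_def calc_dom_def)
  have expansion: "(\<forall>s \<in> {0<..s0}. f \<in> pow_dom E (\<sigma> * s)) \<and> (\<forall>k\<le>m. f \<in> log_power_dom E k) \<and>
      L2_small_o (\<lambda>s x. pow_op E (\<sigma> * s) f x
        - (\<Sum>k=0..m. of_real (\<sigma> ^ k * (s ^ k / fact k)) * log_power E k f x)) m"
    if "\<bar>\<sigma>\<bar> = 1" "f \<in> log_power_dom E (Suc m)" "f \<in> pow_dom E (\<sigma> * s0)" for f \<sigma>
    using log_expansion_of_powers[OF E pos[OF that(2)] that(1) assms(1) that(2,3)]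
      pow_dom_between[OF E that(3)] log_power_dom_le[OF E that(2)] by simp
  show ?thesis
  proof (rule conjI; rule ballI)
    fix f assume "f \<in> log_power_dom E (m + 1) \<inter> pow_dom E s0"
    then have "f \<in> log_power_dom E (Suc m)" "f \<in> pow_dom E (1 * s0)" by simp_all
    from expansion[OF abs_one this, unfolded mult_1_left power_one]
    show "(\<forall>s \<in> {0<..s0}. f \<in> pow_dom E s) \<and> (\<forall>k\<le>m. f \<in> log_power_dom E k) \<and>
        L2_small_o (\<lambda>s x. pow_op E s f x
          - (\<Sum>k=0..m. of_real (s ^ k / fact k) * log_power E k f x)) m"
      .
  next
    fix f assume "f \<in> log_power_dom E (m + 1) \<inter> pow_dom E (- s0)"
    then have "\<bar>- 1 :: real\<bar> = 1" "f \<in> log_power_dom E (Suc m)" "f \<in> pow_dom E (- 1 * s0)"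
      by simp_all
    from expansion[OF this, unfolded mult_minus1]
    show "(\<forall>s \<in> {0<..s0}. f \<in> pow_dom E (- s)) \<and> (\<forall>k\<le>m. f \<in> log_power_dom E k) \<and>
        L2_small_o (\<lambda>s x. pow_op E (- s) f x
          - (\<Sum>k=0..m. of_real ((- 1) ^ k * (s ^ k / fact k)) * log_power E k f x)) m"
      .
  qed
qed

end
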